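(* Let $N\in\mathbb N$. The subspace ${\rm Fix}(G)$ of $V^{\otimes 3}$ becomes an $\mathfrak{sl}_4(\mathbb C)$-module on which $$A_i=A^{(i)},\qquad A^*_i=A^{*(i)}\qquad\qquad i\in\{1,2,3\}.$$ Moreover, the linear map $\ddag:P_N\to{\rm Fix}(G)$ that sends $x^ry^sz^tw^u\mapsto (N!\,2^N)^{1/2}\tilde B(r,s,t,u)$ for all $(r,s,t,u)\in\mathcal P_N$ is an isomorphism of $\mathfrak{sl}_4(\mathbb C)$-modules.
   Context: $\mathbb N=\{0,1,2,\ldots\}$; all vector spaces are over $\mathbb C$. Lie algebra and polynomials: with $E_{a,b}$ the $4\times4$ matrix units, define in $\mathfrak{sl}_4(\mathbb C)$: $A_1=E_{12}+E_{21}+E_{34}+E_{43}$, $A_2=E_{13}+E_{31}+E_{24}+E_{42}$, $A_3=E_{14}+E_{41}+E_{23}+E_{32}$, $A_1^*={\rm diag}(1,1,-1,-1)$, $A_2^*={\rm diag}(1,-1,1,-1)$, $A_3^*={\rm diag}(1,-1,-1,1)$. These six elements generate the Lie algebra $\mathfrak{sl}_4(\mathbb C)$. $P=\mathbb C[x,y,z,w]$ is an $\mathfrak{sl}_4(\mathbb C)$-module on which every element acts as a derivation, and on the degree-one part $\varphi\in\mathfrak{sl}_4(\mathbb C)$ acts by its matrix with respect to the ordered basis $(v_1,v_2,v_3,v_4)=(x,y,z,w)$, i.e. $\varphi v_b=\sum_a\varphi_{ab}v_a$. $P_N$ is the submodule of homogeneous polynomials of total degree $N$, and $\mathcal P_N$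 is the set of $(r,s,t,u)\in\mathbb N^4$ with $r+s+t+u=N$. Hypercube: $H(N,2)$ is the graph with vertex set $X=\{1,-1\}^N$, two vertices being adjacent when they differ in exactly one coordinate; $\partial(x,y)$ is the path-length distance (number of coordinates where $x,y$ differ); $\Gamma(x)$ is the set of neighbours of $x$. $V$ is the vector space with basis $X$; $V^{\otimes 3}$ has basis $X^{\otimes 3}=\{x\otimes y\otimes z:x,y,z\in X\}$. $G$ is the automorphism group of the graph $H(N,2)$, acting linearly on $V$ by permuting $X$ and on $V^{\otimes 3}$ by $g(u\otimes v\otimes w)=g(u)\otimes g(v)\otimes g(w)$; ${\rm Fix}(G)=\{v\in V^{\otimes 3}:g(v)=v\ \forall g\in G\}$. Put $\theta^*_i=N-2i$. The maps $A^{(i)},A^{*(i)}\in{\rm End}(V^{\otimes3})$ are defined on $x\otimes y\otimes z\in X^{\otimes 3}$ by $A^{(1)}(x\otimes y\otimes z)=\sum_{\xi\in\Gamma(x)}\xi\otimes y\otimes z$, $A^{(2)}(x\otimes y\otimes z)=\sum_{\xi\in\Gamma(y)}x\otimes\xi\otimes z$, $A^{(3)}(x\otimes y\otimes z)=\sum_{\xi\in\Gamma(z)}x\otimes y\otimes\xi$, and $A^{*(1)}(x\otimes y\otimes z)=\theta^*_{\partial(y,z)}\,x\otimes y\otimes z$, $A^{*(2)}(x\otimes y\otimes z)=\theta^*_{\partial(z,x)}\,x\otimes y\otimes z$, $A^{*(3)}(x\otimes y\otimes z)=\theta^*_{\partial(x,y)}\,x\otimes y\otimes z$. All six maps leave ${\rm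 Fix}(G)$ invariant. The profile of $x\otimes y\otimes z\in X^{\otimes 3}$ is $(r,s,t,u)\in\mathcal P_N$, where $r=|\{i:x_i=y_i=z_i\}|$, $s=|\{i:x_i\ne y_i=z_i\}|$, $t=|\{i:y_i\neq z_i=x_i\}|$, $u=|\{i:z_i\ne x_i=y_i\}|$. $B(r,s,t,u)$ is the sum of all elements of $X^{\otimes 3}$ with profile $(r,s,t,u)$, and $\tilde B(r,s,t,u)=\frac{r!s!t!u!}{N!\,2^N}B(r,s,t,u)$. The vectors $\tilde B(r,s,t,u)$, $(r,s,t,u)\in\mathcal P_N$, form a basis of ${\rm Fix}(G)$. *)

theory Defs
  imports "HOL-Analysis.Analysis" "HOL-Library.Poly_Mapping" "HOL-Combinatorics.Permutations"
begin

section \<open>Complex vector spaces with a distinguished basis\<close>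

text \<open>
  The finitely supported functions of type \<^typ>\<open>'a \<Rightarrow>\<^sub>0 complex\<close> form the complex vector space
  with basis \<open>Poly_Mapping.single b 1\<close>, where \<open>b\<close> ranges over \<^typ>\<open>'a\<close>.
\<close>

definition pscale :: "complex \<Rightarrow> ('a \<Rightarrow>\<^sub>0 complex) \<Rightarrow> ('a \<Rightarrow>\<^sub>0 complex)" (infixr \<open>\<odot>\<close> 75)
  where "c \<odot> p = Poly_Mapping.map ((*) c) p"

lemma lookup_pscale [simp]:
  "Poly_Mapping.lookup (c \<odot> p) k = c * Poly_Mapping.lookup p k"
  by (simp add: pscale_def Poly_Mapping.map.rep_eq when_def)

interpretation pscale: vector_space pscale
  by unfold_locales (auto intro!: poly_mapping_eqI simp: lookup_add algebra_simps)

interpretation pscale: vector_space_pair pscale pscale ..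

lemma pscale_eq_mult: "c \<odot> p = Poly_Mapping.single 0 c * p"
  for p :: "'a::monoid_add \<Rightarrow>\<^sub>0 complex"
  by (simp add: pscale_def mult_map_scale_conv_mult)

lemma pscale_single [simp]: "c \<odot> Poly_Mapping.single k d = Poly_Mapping.single k (c * d)"
  by (rule poly_mapping_eqI) (simp add: lookup_single when_def)

lemma pm_expand:
  "p = (\<Sum>k\<in>Poly_Mapping.keys p. Poly_Mapping.lookup p k \<odot> Poly_Mapping.single k 1)"
  by (rule poly_mapping_eqI)
    (auto simp: lookup_sum lookup_single when_def in_keys_iff if_distrib cong: if_cong)

text \<open>The linear map with prescribed values on the basis.\<close>

definition lin_ext :: "('a \<Rightarrow> ('b \<Rightarrow>\<^sub>0 complex)) \<Rightarrow> ('a \<Rightarrow>\<^sub>0 complex) \<Rightarrow> ('b \<Rightarrow>\<^sub>0 complex)"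
  where "lin_ext f v = (\<Sum>b\<in>Poly_Mapping.keys v. Poly_Mapping.lookup v b \<odot> f b)"

lemma lin_ext_superset:
  assumes "finite S" "Poly_Mapping.keys v \<subseteq> S"
  shows "lin_ext f v = (\<Sum>b\<in>S. Poly_Mapping.lookup v b \<odot> f b)"
  unfolding lin_ext_def using assms
  by (intro sum.mono_neutral_left) (auto simp: in_keys_iff)

lemma linear_lin_ext: "Vector_Spaces.linear pscale pscale (lin_ext f)"
proof (intro iffD1[OF module_hom_iff_linear] module_hom.intro module_hom_axioms.intro pscale.module_axioms)
  fix v w :: "'a \<Rightarrow>\<^sub>0 complex" and c :: complex
  let ?S = "Poly_Mapping.keys v \<union> Poly_Mapping.keys w"
  have "Poly_Mapping.keys (v + w) \<subseteq> ?S" by (rule keys_add)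
  then show "lin_ext f (v + w) = lin_ext f v + lin_ext f w"
    by (simp add: lin_ext_superset[of ?S] lookup_add pscale.scale_left_distrib sum.distrib)
  have "Poly_Mapping.keys (c \<odot> v) \<subseteq> Poly_Mapping.keys v" by (auto simp: in_keys_iff)
  then show "lin_ext f (c \<odot> v) = c \<odot> lin_ext f v"
    by (simp add: lin_ext_superset[of "Poly_Mapping.keys v"] pscale.scale_sum_right)
qed

lemma lin_ext_single [simp]: "lin_ext f (Poly_Mapping.single b c) = c \<odot> f b"
  by (simp add: lin_ext_def)

lemmas lin_ext_add = linear_lin_ext[THEN Vector_Spaces.linear.axioms(3), THEN module_hom.add]
lemmas lin_ext_scale = linear_lin_ext[THEN Vector_Spaces.linear.axioms(3), THEN module_hom.scale]
lemmas lin_ext_sum = linear_lin_ext[THEN Vector_Spaces.linear.axioms(3), THEN module_hom.sum]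

lemma linear_eq_on_basis:
  assumes "Vector_Spaces.linear pscale pscale f" "Vector_Spaces.linear pscale pscale g"
    and "\<And>b. f (Poly_Mapping.single b 1) = g (Poly_Mapping.single b 1)"
  shows "f = g"
proof
  fix p
  interpret f: Vector_Spaces.linear pscale pscale f by fact
  interpret g: Vector_Spaces.linear pscale pscale g by fact
  have "f p = (\<Sum>k\<in>Poly_Mapping.keys p. Poly_Mapping.lookup p k \<odot> f (Poly_Mapping.single k 1))"
    by (subst pm_expand[of p]) (simp only: f.sum f.scale)
  also have "\<dots> = (\<Sum>k\<in>Poly_Mapping.keys p. Poly_Mapping.lookup p k \<odot> g (Poly_Mapping.single k 1))"
    by (simp only: assms(3))
  also have "\<dots> = g p"
    by (subst (3) pm_expand[of p]) (simp only: g.sum g.scale)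
  finally show "f p = g p" .
qed


section \<open>The Lie algebra \<open>sl\<^sub>4\<close> and its modules\<close>

type_synonym mat4 = "complex^4^4"

definition sl4 :: "mat4 set"
  where "sl4 = {\<phi>. trace \<phi> = 0}"

definition lie_bracket :: "mat4 \<Rightarrow> mat4 \<Rightarrow> mat4"
  where "lie_bracket \<phi> \<psi> = \<phi> ** \<psi> - \<psi> ** \<phi>"

definition mat_scale :: "complex \<Rightarrow> mat4 \<Rightarrow> mat4"
  where "mat_scale c \<phi> = (\<chi> i j. c * \<phi> $ i $ j)"

definition mat_unit :: "4 \<Rightarrow> 4 \<Rightarrow> mat4"
  where "mat_unit a b = (\<chi> i j. if i = a \<and> j = b then 1 else 0)"

definition "A1 = mat_unit 1 2 + mat_unit 2 1 + mat_unit 3 4 + mat_unit 4 3"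
definition "A2 = mat_unit 1 3 + mat_unit 3 1 + mat_unit 2 4 + mat_unit 4 2"
definition "A3 = mat_unit 1 4 + mat_unit 4 1 + mat_unit 2 3 + mat_unit 3 2"
definition "A1s = mat_unit 1 1 + mat_unit 2 2 - mat_unit 3 3 - mat_unit 4 4"
definition "A2s = mat_unit 1 1 - mat_unit 2 2 + mat_unit 3 3 - mat_unit 4 4"
definition "A3s = mat_unit 1 1 - mat_unit 2 2 - mat_unit 3 3 + mat_unit 4 4"

text \<open>
  A module structure on the subspace \<open>W\<close> of an ambient vector space. The action \<open>\<rho>\<close> is a total
  function, about which nothing is said outside \<open>sl4\<close> and \<open>W\<close>.
\<close>

locale sl4_module = vector_space scale
  for scale :: "complex \<Rightarrow> 'v::ab_group_add \<Rightarrow> 'v" +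
  fixes W :: "'v set" and \<rho> :: "mat4 \<Rightarrow> 'v \<Rightarrow> 'v"
  assumes subspace: "module.subspace scale W"
    and closed: "\<lbrakk>\<phi> \<in> sl4; v \<in> W\<rbrakk> \<Longrightarrow> \<rho> \<phi> v \<in> W"
    and add_right: "\<lbrakk>\<phi> \<in> sl4; v \<in> W; v' \<in> W\<rbrakk> \<Longrightarrow> \<rho> \<phi> (v + v') = \<rho> \<phi> v + \<rho> \<phi> v'"
    and scale_right: "\<lbrakk>\<phi> \<in> sl4; v \<in> W\<rbrakk> \<Longrightarrow> \<rho> \<phi> (scale c v) = scale c (\<rho> \<phi> v)"
    and add_left: "\<lbrakk>\<phi> \<in> sl4; \<psi> \<in> sl4; v \<in> W\<rbrakk> \<Longrightarrow> \<rho> (\<phi> + \<psi>) v = \<rho> \<phi> v + \<rho> \<psi> v"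
    and scale_left: "\<lbrakk>\<phi> \<in> sl4; v \<in> W\<rbrakk> \<Longrightarrow> \<rho> (mat_scale c \<phi>) v = scale c (\<rho> \<phi> v)"
    and bracket: "\<lbrakk>\<phi> \<in> sl4; \<psi> \<in> sl4; v \<in> W\<rbrakk>
      \<Longrightarrow> \<rho> (lie_bracket \<phi> \<psi>) v = \<rho> \<phi> (\<rho> \<psi> v) - \<rho> \<psi> (\<rho> \<phi> v)"

locale sl4_module_iso =
  source: sl4_module scale1 W1 \<rho>1 + target: sl4_module scale2 W2 \<rho>2
  for scale1 :: "complex \<Rightarrow> 'v::ab_group_add \<Rightarrow> 'v" and W1 \<rho>1
    and scale2 :: "complex \<Rightarrow> 'w::ab_group_add \<Rightarrow> 'w" and W2 \<rho>2 +
  fixes f :: "'v \<Rightarrow> 'w"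
  assumes bij: "bij_betw f W1 W2"
    and add: "\<lbrakk>v \<in> W1; v' \<in> W1\<rbrakk> \<Longrightarrow> f (v + v') = f v + f v'"
    and scale: "v \<in> W1 \<Longrightarrow> f (scale1 c v) = scale2 c (f v)"
    and equivariant: "\<lbrakk>\<phi> \<in> sl4; v \<in> W1\<rbrakk> \<Longrightarrow> f (\<rho>1 \<phi> v) = \<rho>2 \<phi> (f v)"


section \<open>The polynomial ring in four variables\<close>

text \<open>
  A monomial is its exponent vector; the product of \<^type>\<open>poly_mapping\<close> is then the usual
  product of polynomials.
\<close>

type_synonym poly4 = "(4 \<Rightarrow>\<^sub>0 nat) \<Rightarrow>\<^sub>0 complex"

definition pvar :: "4 \<Rightarrow> poly4"
  where "pvar b = Poly_Mapping.single (Poly_Mapping.single b 1) 1"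

definition monom4 :: "nat \<Rightarrow> nat \<Rightarrow> nat \<Rightarrow> nat \<Rightarrow> poly4"
  where "monom4 r s t u = pvar 1 ^ r * pvar 2 ^ s * pvar 3 ^ t * pvar 4 ^ u"

definition homog :: "nat \<Rightarrow> poly4 set"
  where "homog N = {p. \<forall>m\<in>Poly_Mapping.keys p. (\<Sum>b\<in>UNIV. Poly_Mapping.lookup m b) = N}"

definition derivation :: "(poly4 \<Rightarrow> poly4) \<Rightarrow> bool"
  where "derivation D \<longleftrightarrow>
    Vector_Spaces.linear pscale pscale D \<and> (\<forall>p q. D (p * q) = D p * q + p * D q)"

definition acts_by :: "mat4 \<Rightarrow> (poly4 \<Rightarrow> poly4) \<Rightarrow> bool"
  where "acts_by \<phi> D \<longleftrightarrow> derivation D \<and> (\<forall>b. D (pvar b) = (\<Sum>a\<in>UNIV. \<phi> $ a $ b \<odot> pvar a))"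

definition poly_act :: "mat4 \<Rightarrow> poly4 \<Rightarrow> poly4"
  where "poly_act \<phi> = (THE D. acts_by \<phi> D)"

lemma derivation_unique:
  assumes "derivation D" "derivation D'" and eq: "\<And>b. D (pvar b) = D' (pvar b)"
  shows "D = D'"
proof (rule linear_eq_on_basis)
  show "Vector_Spaces.linear pscale pscale D" "Vector_Spaces.linear pscale pscale D'"
    using assms by (auto simp: derivation_def)
  have leib: "D (p * q) = D p * q + p * D q" "D' (p * q) = D' p * q + p * D' q" for p q
    using assms by (auto simp: derivation_def)
  have one: "D 1 = 0" "D' 1 = 0" using leib[of 1 1] by auto
  fix m :: "4 \<Rightarrow>\<^sub>0 nat"
  show "D (Poly_Mapping.single m 1) = D' (Poly_Mapping.single m 1)"
  proof (induction "\<Sum>b\<in>UNIV. Poly_Mapping.lookup m b" arbitrary: m)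
    case 0
    then have "m = 0" by (intro poly_mapping_eqI) auto
    then show ?case using one by simp
  next
    case (Suc k)
    then have "\<exists>b. Poly_Mapping.lookup m b \<noteq> 0"
      by (metis nat.distinct(1) sum.neutral)
    then obtain b where b: "Poly_Mapping.lookup m b \<noteq> 0" by blast
    define m' where "m' = m - Poly_Mapping.single b 1"
    have m: "m = Poly_Mapping.single b 1 + m'"
      using b by (intro poly_mapping_eqI)
        (auto simp: m'_def lookup_add lookup_minus lookup_single when_def)
    have "Suc k = (\<Sum>c\<in>UNIV. Poly_Mapping.lookup (Poly_Mapping.single b (1::nat)) c)
                + (\<Sum>c\<in>UNIV. Poly_Mapping.lookup m' c)"
      using Suc(2) by (subst (asm) m) (simp add: lookup_add sum.distrib)
    also have "(\<Sum>c\<in>UNIV. Poly_Mapping.lookup (Poly_Mapping.single b (1::nat)) c) = 1"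
      by (simp add: lookup_single when_def)
    finally have "D (Poly_Mapping.single m' 1) = D' (Poly_Mapping.single m' 1)"
      by (intro Suc(1)) simp
    moreover have "Poly_Mapping.single m 1 = pvar b * Poly_Mapping.single m' (1::complex)"
      by (simp add: pvar_def mult_single m)
    ultimately show ?case by (simp add: leib eq)
  qed
qed

lemma acts_by_exists:
  "acts_by \<phi> (lin_ext (\<lambda>m. \<Sum>b\<in>UNIV. \<Sum>a\<in>UNIV. Poly_Mapping.single
      (m - Poly_Mapping.single b 1 + Poly_Mapping.single a 1)
      (\<phi> $ a $ b * of_nat (Poly_Mapping.lookup m b))))"
    (is "acts_by \<phi> (lin_ext ?T)")
proof -
  note lin = linear_lin_ext[of ?T]
  have mono: "?T (m + n) = ?T m * Poly_Mapping.single n 1 + Poly_Mapping.single m 1 * ?T n"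
    for m n :: "4 \<Rightarrow>\<^sub>0 nat"
  proof -
    have *: "Poly_Mapping.single (m + n - Poly_Mapping.single b 1 + Poly_Mapping.single a 1)
            (c * of_nat (Poly_Mapping.lookup (m + n) b) :: complex)
        = Poly_Mapping.single (m - Poly_Mapping.single b 1 + Poly_Mapping.single a 1 + n)
            (c * of_nat (Poly_Mapping.lookup m b))
        + Poly_Mapping.single (m + (n - Poly_Mapping.single b 1 + Poly_Mapping.single a 1))
            (c * of_nat (Poly_Mapping.lookup n b))" for a b c
    proof -
      have 1: "m - Poly_Mapping.single b 1 + Poly_Mapping.single a 1 + n
          = m + n - Poly_Mapping.single b 1 + Poly_Mapping.single a 1"
        if "Poly_Mapping.lookup m b \<noteq> 0"
        using that by (intro poly_mapping_eqI)
          (auto simp: lookup_add lookup_minus lookup_single when_def)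
      have 2: "m + (n - Poly_Mapping.single b 1 + Poly_Mapping.single a 1)
          = m + n - Poly_Mapping.single b 1 + Poly_Mapping.single a 1"
        if "Poly_Mapping.lookup n b \<noteq> 0"
        using that by (intro poly_mapping_eqI)
          (auto simp: lookup_add lookup_minus lookup_single when_def)
      show ?thesis
        using 1 2 by (cases "Poly_Mapping.lookup m b = 0"; cases "Poly_Mapping.lookup n b = 0")
          (simp_all add: lookup_add single_add distrib_left)
    qed
    show ?thesis
      unfolding * by (simp add: sum.distrib sum_distrib_left sum_distrib_right mult_single)
  qed
  have "lin_ext ?T (p * q) = lin_ext ?T p * q + p * lin_ext ?T q" for p q
  proof -
    let ?l = "Poly_Mapping.lookup" and ?k = "Poly_Mapping.keys"
    let ?s = "\<lambda>m. Poly_Mapping.single m (1::complex) :: poly4"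
    have scale_mult: "c \<odot> x * y = c \<odot> (x * y)" "x * c \<odot> y = c \<odot> (x * y)" for c and x y :: poly4
      by (simp_all add: pscale_eq_mult algebra_simps)
    have "p * q = (\<Sum>m\<in>?k p. \<Sum>n\<in>?k q. ?l p m \<odot> ?l q n \<odot> ?s (m + n))"
      by (subst pm_expand[of p], subst pm_expand[of q])
        (simp add: sum_product mult_single)
    then have "lin_ext ?T (p * q) = (\<Sum>m\<in>?k p. \<Sum>n\<in>?k q. ?l p m \<odot> ?l q n \<odot> ?T (m + n))"
      by (simp only: lin_ext_sum lin_ext_scale lin_ext_single pscale.scale_one)
    also have "\<dots> = (\<Sum>m\<in>?k p. \<Sum>n\<in>?k q. ?l p m \<odot> ?T m * ?l q n \<odot> ?s n)
                 + (\<Sum>m\<in>?k p. \<Sum>n\<in>?k q. ?l p m \<odot> ?s m * ?l q n \<odot> ?T n)"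
      unfolding mono by (simp only: scale_mult pscale.scale_right_distrib sum.distrib)
        (simp only: pscale.scale_scale mult.commute)
    also have "\<dots> = lin_ext ?T p * (\<Sum>n\<in>?k q. ?l q n \<odot> ?s n)
                  + (\<Sum>m\<in>?k p. ?l p m \<odot> ?s m) * lin_ext ?T q"
      by (simp only: sum_product lin_ext_def)
    finally show ?thesis by (simp only: pm_expand[symmetric])
  qed
  moreover have "lin_ext ?T (pvar b) = (\<Sum>a\<in>UNIV. \<phi> $ a $ b \<odot> pvar a)" for b
  proof -
    have "?T (Poly_Mapping.single b 1) = (\<Sum>c\<in>UNIV. if c = b then
        (\<Sum>a\<in>UNIV. Poly_Mapping.single (Poly_Mapping.single a 1) (\<phi> $ a $ b)) else 0)"
      by (intro sum.cong refl) (auto simp: lookup_single when_def)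
    then show ?thesis by (simp add: pvar_def)
  qed
  ultimately show ?thesis using lin by (auto simp: acts_by_def derivation_def)
qed

lemma acts_by_poly_act: "acts_by \<phi> (poly_act \<phi>)"
  unfolding poly_act_def
proof (rule theI'[of "acts_by \<phi>"], rule ex_ex1I)
  show "\<exists>D. acts_by \<phi> D" using acts_by_exists by blast
  show "D = D'" if "acts_by \<phi> D" "acts_by \<phi> D'" for D D'
    using that by (intro derivation_unique) (auto simp: acts_by_def)
qed


section \<open>The hypercube\<close>

type_synonym vertex = "nat \<Rightarrow> int"

definition cube :: "nat \<Rightarrow> vertex set"
  where "cube N = {..<N} \<rightarrow>\<^sub>E {1, -1}"

definition adj :: "nat \<Rightarrow> vertex rel"
  where "adj N = {(x, y). x \<in> cube N \<and> y \<in> cube N \<and> card {i \<in> {..<N}. x i \<noteq> y i} = 1}"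

definition nbrs :: "nat \<Rightarrow> vertex \<Rightarrow> vertex set"
  where "nbrs N x = {y. (x, y) \<in> adj N}"

definition path_dist :: "nat \<Rightarrow> vertex \<Rightarrow> vertex \<Rightarrow> nat"
  where "path_dist N x y = (LEAST n. (x, y) \<in> adj N ^^ n)"

definition Aut :: "nat \<Rightarrow> (vertex \<Rightarrow> vertex) set"
  where "Aut N = {g. g permutes cube N \<and>
    (\<forall>x\<in>cube N. \<forall>y\<in>cube N. (g x, g y) \<in> adj N \<longleftrightarrow> (x, y) \<in> adj N)}"

lemma path_dist_eq_card:
  assumes "x \<in> cube N" "y \<in> cube N"
  shows "path_dist N x y = card {i \<in> {..<N}. x i \<noteq> y i}"
  unfolding path_dist_def
proof (rule Least_equality)
  show "(x, y) \<in> adj N ^^ card {i \<in> {..<N}. x i \<noteq> y i}"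
    using assms
  proof (induction "card {i \<in> {..<N}. x i \<noteq> y i}" arbitrary: x)
    case 0
    then have "{i \<in> {..<N}. x i \<noteq> y i} = {}" by simp
    then have "x = y" using 0 by (intro PiE_ext[of x "{..<N}" _ y]) (auto simp: cube_def)
    then show ?case using 0 by (metis relpow_0_I)
  next
    case (Suc k)
    from Suc(2) have "{i \<in> {..<N}. x i \<noteq> y i} \<noteq> {}" by (metis card.empty nat.distinct(1))
    then obtain j where j: "j < N" "x j \<noteq> y j" by auto
    define z where "z = x(j := y j)"
    have zX: "z \<in> cube N" using Suc(3,4) j by (auto simp: z_def cube_def PiE_iff extensional_def)
    have "{i \<in> {..<N}. x i \<noteq> z i} = {j}" using j by (auto simp: z_def)
    then have xz: "(x, z) \<in> adj N" using Suc zX by (simp add: adj_def)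
    have "{i \<in> {..<N}. z i \<noteq> y i} = {i \<in> {..<N}. x i \<noteq> y i} - {j}" by (auto simp: z_def)
    then have k: "k = card {i \<in> {..<N}. z i \<noteq> y i}" using j Suc(2) by simp
    have "(z, y) \<in> adj N ^^ k" using Suc(1)[OF k zX Suc(4)] k by simp
    then show ?case using xz Suc(2) by (metis relpow_Suc_I2)
  qed
next
  fix n assume "(x, y) \<in> adj N ^^ n"
  then show "card {i \<in> {..<N}. x i \<noteq> y i} \<le> n"
  proof (induction n arbitrary: y)
    case 0
    then show ?case by simp
  next
    case (Suc n)
    then obtain z where z: "(x, z) \<in> adj N ^^ n" "(z, y) \<in> adj N" by auto
    have "card {i \<in> {..<N}. x i \<noteq> y i}
        \<le> card ({i \<in> {..<N}. x i \<noteq> z i} \<union> {i \<in> {..<N}. z i \<noteq> y i})"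
      by (intro card_mono) auto
    also have "\<dots> \<le> card {i \<in> {..<N}. x i \<noteq> z i} + card {i \<in> {..<N}. z i \<noteq> y i}"
      by (rule card_Un_le)
    also have "\<dots> \<le> n + 1" using Suc.IH[OF z(1)] z(2) by (simp add: adj_def)
    finally show ?case by simp
  qed
qed


section \<open>The tensor cube and the fixed space\<close>

text \<open>
  The space \<open>V\<close> is the span of \<open>cube N\<close> inside \<^typ>\<open>vertex \<Rightarrow>\<^sub>0 complex\<close>, and its tensor cube is the
  span of \<open>cube N \<times> cube N \<times> cube N\<close> inside \<^typ>\<open>(vertex \<times> vertex \<times> vertex) \<Rightarrow>\<^sub>0 complex\<close>; the basis
  vector \<open>tens x y z\<close> is \<open>x \<otimes> y \<otimes> z\<close>.
\<close>

type_synonym vert_vec = "vertex \<Rightarrow>\<^sub>0 complex"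
type_synonym vec3 = "(vertex \<times> vertex \<times> vertex) \<Rightarrow>\<^sub>0 complex"

definition V3 :: "nat \<Rightarrow> vec3 set"
  where "V3 N = {v. Poly_Mapping.keys v \<subseteq> cube N \<times> cube N \<times> cube N}"

definition tens :: "vertex \<Rightarrow> vertex \<Rightarrow> vertex \<Rightarrow> vec3"
  where "tens x y z = Poly_Mapping.single (x, y, z) 1"

definition act3 :: "(vertex \<Rightarrow> vertex) \<Rightarrow> vec3 \<Rightarrow> vec3"
  where "act3 g = lin_ext (\<lambda>(x, y, z). tens (g x) (g y) (g z))"

text \<open>
  On the tensor product of three arbitrary vectors, \<open>act3\<close> is
  \<open>g (u \<otimes> v \<otimes> w) = g u \<otimes> g v \<otimes> g w\<close>.
\<close>

definition tensor3 :: "vert_vec \<Rightarrow> vert_vec \<Rightarrow> vert_vec \<Rightarrow> vec3"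
  where "tensor3 u v w = lin_ext (\<lambda>x. lin_ext (\<lambda>y. lin_ext (\<lambda>z. tens x y z) w) v) u"

definition act1 :: "(vertex \<Rightarrow> vertex) \<Rightarrow> vert_vec \<Rightarrow> vert_vec"
  where "act1 g = lin_ext (\<lambda>x. Poly_Mapping.single (g x) 1)"

lemma act3_tensor3: "act3 g (tensor3 u v w) = tensor3 (act1 g u) (act1 g v) (act1 g w)"
proof -
  have push: "lin_ext f (act1 g u) = lin_ext (\<lambda>x. f (g x)) u" for f :: "vertex \<Rightarrow> vec3" and u
    by (simp add: act1_def lin_ext_def[of _ u] lin_ext_sum lin_ext_scale)
  have comm: "act3 g (lin_ext f u) = lin_ext (\<lambda>x. act3 g (f x)) u"
    for f :: "vertex \<Rightarrow> vec3" and u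
    by (simp add: act3_def lin_ext_def[of _ u] lin_ext_sum lin_ext_scale)
  show ?thesis
    by (simp add: tensor3_def push comm) (simp add: act3_def tens_def)
qed

definition FixG :: "nat \<Rightarrow> vec3 set"
  where "FixG N = {v \<in> V3 N. \<forall>g\<in>Aut N. act3 g v = v}"

definition Aup1 :: "nat \<Rightarrow> vec3 \<Rightarrow> vec3"
  where "Aup1 N = lin_ext (\<lambda>(x, y, z). \<Sum>\<xi>\<in>nbrs N x. tens \<xi> y z)"

definition Aup2 :: "nat \<Rightarrow> vec3 \<Rightarrow> vec3"
  where "Aup2 N = lin_ext (\<lambda>(x, y, z). \<Sum>\<xi>\<in>nbrs N y. tens x \<xi> z)"

definition Aup3 :: "nat \<Rightarrow> vec3 \<Rightarrow> vec3"
  where "Aup3 N = lin_ext (\<lambda>(x, y, z). \<Sum>\<xi>\<in>nbrs N z. tens x y \<xi>)"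

definition theta_s :: "nat \<Rightarrow> nat \<Rightarrow> complex"
  where "theta_s N i = of_nat N - 2 * of_nat i"

definition Aup1s :: "nat \<Rightarrow> vec3 \<Rightarrow> vec3"
  where "Aup1s N = lin_ext (\<lambda>(x, y, z). theta_s N (path_dist N y z) \<odot> tens x y z)"

definition Aup2s :: "nat \<Rightarrow> vec3 \<Rightarrow> vec3"
  where "Aup2s N = lin_ext (\<lambda>(x, y, z). theta_s N (path_dist N z x) \<odot> tens x y z)"

definition Aup3s :: "nat \<Rightarrow> vec3 \<Rightarrow> vec3"
  where "Aup3s N = lin_ext (\<lambda>(x, y, z). theta_s N (path_dist N x y) \<odot> tens x y z)"

definition profile ::
    "nat \<Rightarrow> vertex \<Rightarrow> vertex \<Rightarrow> vertex \<Rightarrow> nat \<times> nat \<times> nat \<times> nat"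
  where "profile N x y z =
    (card {i \<in> {..<N}. x i = y i \<and> y i = z i},
     card {i \<in> {..<N}. x i \<noteq> y i \<and> y i = z i},
     card {i \<in> {..<N}. y i \<noteq> z i \<and> z i = x i},
     card {i \<in> {..<N}. z i \<noteq> x i \<and> x i = y i})"

definition B_sum :: "nat \<Rightarrow> nat \<Rightarrow> nat \<Rightarrow> nat \<Rightarrow> nat \<Rightarrow> vec3"
  where "B_sum N r s t u =
    (\<Sum>(x, y, z) \<in> {(x, y, z) \<in> cube N \<times> cube N \<times> cube N. profile N x y z = (r, s, t, u)}. tens x y z)"

definition B_tilde :: "nat \<Rightarrow> nat \<Rightarrow> nat \<Rightarrow> nat \<Rightarrow> nat \<Rightarrow> vec3"
  where "B_tilde N r s t u = (fact r * fact s * fact t * fact u / (fact N * 2 ^ N)) \<odot> B_sum N r s t u"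

definition ddag :: "nat \<Rightarrow> poly4 \<Rightarrow> vec3"
  where "ddag N = lin_ext (\<lambda>m. of_real (sqrt (fact N * 2 ^ N)) \<odot>
    B_tilde N (Poly_Mapping.lookup m 1) (Poly_Mapping.lookup m 2)
              (Poly_Mapping.lookup m 3) (Poly_Mapping.lookup m 4))"

lemma pvar_power: "pvar b ^ n = Poly_Mapping.single (Poly_Mapping.single b n) 1"
  by (induction n) (simp_all add: pvar_def mult_single single_add[symmetric])

lemma ddag_monom4:
  "ddag N (monom4 r s t u) = of_real (sqrt (fact N * 2 ^ N)) \<odot> B_tilde N r s t u"
  by (simp add: ddag_def monom4_def pvar_power mult_single lookup_add lookup_single when_def)

end

theory Submission
  imports Defs
begin

text \<open>
  The coefficient of \<open>\<ddagger> p\<close> at a triple depends only on its profile \<open>m = (r, s, t, u)\<close> and equals,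
  up to a nonzero constant, \<open>r! s! t! u!\<close> times the coefficient of \<open>p\<close> at \<open>m\<close>. The automorphism group
  of the cube acts transitively on the triples of a given profile, so \<open>\<ddagger>\<close> is a bijection from \<open>P\<^sub>N\<close>
  to \<open>Fix(G)\<close>. The factorials turn the action of a matrix unit \<open>E\<^sub>a\<^sub>b\<close> into a sum over the \<open>m\<^sub>a\<close>
  coordinates of type \<open>a\<close>, each of which is given the type \<open>b\<close>. Changing a sign in \<open>x\<close>, \<open>y\<close> or \<open>z\<close>
  permutes the four types as \<open>A\<^sub>1\<close>, \<open>A\<^sub>2\<close>, \<open>A\<^sub>3\<close> permute the variables, hence \<open>\<ddagger>\<close> intertwines the
  generators. The structure on \<open>Fix(G)\<close> is transported from \<open>P\<^sub>N\<close>; since the six elements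
  generate \<open>sl\<^sub>4\<close>, every admissible structure is compatible with \<open>\<ddagger>\<close>.
\<close>

abbreviation lookup where "lookup \<equiv> Poly_Mapping.lookup"
abbreviation keys where "keys \<equiv> Poly_Mapping.keys"
abbreviation single where "single \<equiv> Poly_Mapping.single"

section \<open>Generation of \<open>sl\<^sub>4\<close>\<close>

lemma mat_scale_nth [simp]: "mat_scale c \<phi> $ i $ j = c * \<phi> $ i $ j"
  by (simp add: mat_scale_def)

lemma mat_unit_nth [simp]: "mat_unit a b $ i $ j = (if i = a \<and> j = b then 1 else 0)"
  by (simp add: mat_unit_def)

lemma lie_bracket_nth:
  "lie_bracket \<phi> \<psi> $ i $ j = (\<Sum>k\<in>UNIV. \<phi> $ i $ k * \<psi> $ k $ j - \<psi> $ i $ k * \<phi> $ k $ j)"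
  by (simp add: lie_bracket_def matrix_matrix_mult_def sum_subtractf)

lemma sl4_closed:
  "\<phi> \<in> sl4 \<Longrightarrow> \<psi> \<in> sl4 \<Longrightarrow> \<phi> + \<psi> \<in> sl4"
  "\<phi> \<in> sl4 \<Longrightarrow> mat_scale c \<phi> \<in> sl4"
  "lie_bracket \<phi> \<psi> \<in> sl4"
proof -
  show "\<phi> \<in> sl4 \<Longrightarrow> \<psi> \<in> sl4 \<Longrightarrow> \<phi> + \<psi> \<in> sl4"
    by (simp add: sl4_def trace_add)
  show "\<phi> \<in> sl4 \<Longrightarrow> mat_scale c \<phi> \<in> sl4"
    by (simp add: sl4_def trace_def flip: sum_distrib_left)
  show "lie_bracket \<phi> \<psi> \<in> sl4"
    using trace_mul_sym[of \<phi> \<psi>] by (simp add: sl4_def lie_bracket_def trace_sub)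
qed

lemmas generator_defs = A1_def A2_def A3_def A1s_def A2s_def A3s_def

lemma generators_in_sl4: "A1 \<in> sl4" "A2 \<in> sl4" "A3 \<in> sl4" "A1s \<in> sl4" "A2s \<in> sl4" "A3s \<in> sl4"
  by (simp_all add: sl4_def trace_def sum_4 generator_defs)

text \<open>The three starred generators are diagonal, so bracketing with them has the matrix units
  as eigenvectors and the differences of diagonal entries as eigenvalues.\<close>

lemma bracket_A1s: "lie_bracket A1s \<psi> $ i $ j = (A1s $ i $ i - A1s $ j $ j) * \<psi> $ i $ j"
  and bracket_A2s: "lie_bracket A2s \<psi> $ i $ j = (A2s $ i $ i - A2s $ j $ j) * \<psi> $ i $ j"
  and bracket_A3s: "lie_bracket A3s \<psi> $ i $ j = (A3s $ i $ i - A3s $ j $ j) * \<psi> $ i $ j"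
  using exhaust_4[of i] exhaust_4[of j]
  by (auto simp: lie_bracket_nth generator_defs sum_4)

text \<open>
  Each \<open>A\<^sub>k\<close> is a sum of four matrix units on which the diagonal generators have distinct pairs of
  weights, so that every matrix unit is obtained from \<open>A\<^sub>k\<close> by a spectral projection.
\<close>

lemma sl4_generated:
  assumes gen: "A1 \<in> L" "A2 \<in> L" "A3 \<in> L" "A1s \<in> L" "A2s \<in> L" "A3s \<in> L"
    and add: "\<And>\<phi> \<psi>. \<phi> \<in> L \<Longrightarrow> \<psi> \<in> L \<Longrightarrow> \<phi> + \<psi> \<in> L"
    and scale: "\<And>c \<phi>. \<phi> \<in> L \<Longrightarrow> mat_scale c \<phi> \<in> L"
    and bracket: "\<And>\<phi> \<psi>. \<phi> \<in> L \<Longrightarrow> \<psi> \<in> L \<Longrightarrow> lie_bracket \<phi> \<psi> \<in> L"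
  shows "sl4 \<subseteq> L"
proof
  \<comment> \<open>This is \<open>(2 + c ad H)(2 + d ad K) / 16\<close>. In the cases used below,
    both eigenvalues are 2 or -2 at every nonzero entry of \<open>\<psi>\<close>, so for signs
    \<open>c\<close>, \<open>d\<close> only the entry with eigenvalues \<open>2 c\<close> and
    \<open>2 d\<close> survives, with factor 1.\<close>
  define proj where "proj c d H K \<psi> = mat_scale (1/4) \<psi> + mat_scale (c/8) (lie_bracket H \<psi>)
      + mat_scale (d/8) (lie_bracket K \<psi>) + mat_scale (c * d/16) (lie_bracket H (lie_bracket K \<psi>))"
    for c d H K \<psi>
  have proj: "proj c d H K \<psi> \<in> L" if "H \<in> L" "K \<in> L" "\<psi> \<in> L" for c d H K \<psi>
    unfolding proj_def by (intro add scale bracket that)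
  have proj_nth: "proj c d H K \<psi> $ i $ j
      = (2 + c * (H $ i $ i - H $ j $ j)) * (2 + d * (K $ i $ i - K $ j $ j)) / 16 * \<psi> $ i $ j"
    if "H \<in> {A1s, A2s, A3s}" "K \<in> {A1s, A2s, A3s}" for c d H K \<psi> i j
    using that by (auto simp: proj_def bracket_A1s bracket_A2s bracket_A3s field_simps)
  have "mat_unit 1 2 = proj 1 1 A2s A3s A1" "mat_unit 2 1 = proj (-1) (-1) A2s A3s A1"
    "mat_unit 3 4 = proj 1 (-1) A2s A3s A1" "mat_unit 4 3 = proj (-1) 1 A2s A3s A1"
    "mat_unit 1 3 = proj 1 1 A1s A3s A2" "mat_unit 3 1 = proj (-1) (-1) A1s A3s A2"
    "mat_unit 2 4 = proj 1 (-1) A1s A3s A2" "mat_unit 4 2 = proj (-1) 1 A1s A3s A2"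
    "mat_unit 1 4 = proj 1 1 A1s A2s A3" "mat_unit 4 1 = proj (-1) (-1) A1s A2s A3"
    "mat_unit 2 3 = proj 1 (-1) A1s A2s A3" "mat_unit 3 2 = proj (-1) 1 A1s A2s A3"
    by (simp_all only: vec_eq_iff forall_4 proj_nth[OF insertI1 insertI2[OF insertI1]]
        proj_nth[OF insertI1 insertI2[OF insertI2[OF insertI1]]]
        proj_nth[OF insertI2[OF insertI1] insertI2[OF insertI2[OF insertI1]]])
      (simp_all add: generator_defs)
  then have unit: "mat_unit a b \<in> L" if "a \<noteq> b" for a b
    using exhaust_4[of a] exhaust_4[of b] that by (auto intro!: proj gen)
  fix \<phi> assume "\<phi> \<in> sl4"
  then have tr: "\<phi> $ 4 $ 4 = - \<phi> $ 1 $ 1 - \<phi> $ 2 $ 2 - \<phi> $ 3 $ 3"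
    by (simp add: sl4_def trace_def sum_4) algebra
  \<comment> \<open>A diagonal (d1, d2, d3, d4) of trace zero has coefficients (d1+d2)/2, (d1+d3)/2,
    (d1+d4)/2 in the starred generators; the last is rewritten by d1+d4 = -(d2+d3).\<close>
  have "\<phi> = mat_scale ((\<phi> $ 1 $ 1 + \<phi> $ 2 $ 2) / 2) A1s
      + mat_scale ((\<phi> $ 1 $ 1 + \<phi> $ 3 $ 3) / 2) A2s + mat_scale (- (\<phi> $ 2 $ 2 + \<phi> $ 3 $ 3) / 2) A3s
      + mat_scale (\<phi> $ 1 $ 2) (mat_unit 1 2) + mat_scale (\<phi> $ 1 $ 3) (mat_unit 1 3)
      + mat_scale (\<phi> $ 1 $ 4) (mat_unit 1 4) + mat_scale (\<phi> $ 2 $ 1) (mat_unit 2 1)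
      + mat_scale (\<phi> $ 2 $ 3) (mat_unit 2 3) + mat_scale (\<phi> $ 2 $ 4) (mat_unit 2 4)
      + mat_scale (\<phi> $ 3 $ 1) (mat_unit 3 1) + mat_scale (\<phi> $ 3 $ 2) (mat_unit 3 2)
      + mat_scale (\<phi> $ 3 $ 4) (mat_unit 3 4) + mat_scale (\<phi> $ 4 $ 1) (mat_unit 4 1)
      + mat_scale (\<phi> $ 4 $ 2) (mat_unit 4 2) + mat_scale (\<phi> $ 4 $ 3) (mat_unit 4 3)"
    by (simp add: vec_eq_iff forall_4 A1s_def A2s_def A3s_def tr field_simps)
  also have "\<dots> \<in> L" by (intro add scale unit gen) simp_all
  finally show "\<phi> \<in> L" .
qed

section \<open>Isomorphisms of modules and transport of structure\<close>

text \<open>The matrices whose actions \<open>f\<close> intertwines are closed under sums, multiples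
  and brackets, so by \<open>sl4_generated\<close> testing the six generators suffices.\<close>

lemma sl4_module_isoI:
  assumes M1: "sl4_module scale1 W1 \<rho>1" and M2: "sl4_module scale2 W2 \<rho>2"
    and bij: "bij_betw f W1 W2"
    and add: "\<And>v v'. f (v + v') = f v + f v'"
    and scale: "\<And>c v. f (scale1 c v) = scale2 c (f v)"
    and gen: "\<And>\<phi> v. \<phi> \<in> {A1, A2, A3, A1s, A2s, A3s} \<Longrightarrow> v \<in> W1 \<Longrightarrow> f (\<rho>1 \<phi> v) = \<rho>2 \<phi> (f v)"
  shows "sl4_module_iso scale1 W1 \<rho>1 scale2 W2 \<rho>2 f"
proof -
  interpret M1: sl4_module scale1 W1 \<rho>1 by fact
  interpret M2: sl4_module scale2 W2 \<rho>2 by fact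
  have fW: "f v \<in> W2" if "v \<in> W1" for v using bij that by (auto simp: bij_betw_def)
  have diff: "f (v - v') = f v - f v'" for v v'
    using add[of "v - v'" v'] by simp
  let ?L = "{\<phi> \<in> sl4. \<forall>v\<in>W1. f (\<rho>1 \<phi> v) = \<rho>2 \<phi> (f v)}"
  have "sl4 \<subseteq> ?L"
    by (rule sl4_generated)
      (auto simp: gen generators_in_sl4 sl4_closed add scale diff fW M1.closed M2.closed M1.add_left
        M2.add_left M1.scale_left M2.scale_left M1.bracket M2.bracket)
  then show ?thesis
    by unfold_locales (use bij add scale in auto)
qed

text \<open>Conjugation by \<open>f\<close> carries the action over. \<open>W2\<close> is a subspace
  as the image of \<open>W1\<close>, and \<open>inv_into W1 f\<close> is linear on it because
  \<open>f\<close> is linear and injective on \<open>W1\<close>.\<close>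

lemma sl4_module_transport:
  assumes M1: "sl4_module scale1 W1 \<rho>1" and V2: "vector_space scale2"
    and bij: "bij_betw f W1 W2"
    and add: "\<And>v v'. f (v + v') = f v + f v'"
    and scale: "\<And>c v. f (scale1 c v) = scale2 c (f v)"
  shows "sl4_module scale2 W2 (\<lambda>\<phi> w. f (\<rho>1 \<phi> (inv_into W1 f w)))"
proof -
  interpret M1: sl4_module scale1 W1 \<rho>1 by fact
  interpret V2: vector_space scale2 by fact
  have W2: "W2 = f ` W1" and inj: "inj_on f W1" using bij by (auto simp: bij_betw_def)
  have fW: "f v \<in> W2" if "v \<in> W1" for v using that W2 by auto
  have diff: "f (v - v') = f v - f v'" for v v'
    using add[of "v - v'" v'] by simp
  have inv: "inv_into W1 f (f v) = v" if "v \<in> W1" for v using inj that by simp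
  note sub = M1.subspace_add[OF M1.subspace] M1.subspace_scale[OF M1.subspace]
    M1.subspace_0[OF M1.subspace]
  have "V2.subspace W2"
  proof (rule V2.subspaceI)
    show "0 \<in> W2" using add[of 0 0] sub(3) by (auto simp: W2 image_iff)
    show "x + y \<in> W2" if "x \<in> W2" "y \<in> W2" for x y
      using that sub(1) by (auto simp: W2 simp flip: add)
    show "scale2 c x \<in> W2" if "x \<in> W2" for x c
      using that sub(2) by (auto simp: W2 simp flip: scale)
  qed
  have inv_add: "inv_into W1 f (f v + f v') = v + v'" if "v \<in> W1" "v' \<in> W1" for v v'
    using that sub by (simp add: inv flip: add)
  have inv_scale: "inv_into W1 f (scale2 c (f v)) = scale1 c v" if "v \<in> W1" for c v
    using that sub by (simp add: inv flip: scale)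
  show ?thesis
  proof (intro sl4_module.intro V2 sl4_module_axioms.intro)
    show "V2.subspace W2" by fact
  next
    fix \<phi> w assume "\<phi> \<in> sl4" "w \<in> W2"
    then show "f (\<rho>1 \<phi> (inv_into W1 f w)) \<in> W2"
      unfolding W2 using M1.closed inv by auto
  next
    fix \<phi> w w' assume "\<phi> \<in> sl4" "w \<in> W2" "w' \<in> W2"
    then show "f (\<rho>1 \<phi> (inv_into W1 f (w + w')))
        = f (\<rho>1 \<phi> (inv_into W1 f w)) + f (\<rho>1 \<phi> (inv_into W1 f w'))"
      unfolding W2 using inv inv_add M1.add_right add by auto
  next
    fix \<phi> w c assume "\<phi> \<in> sl4" "w \<in> W2"
    then show "f (\<rho>1 \<phi> (inv_into W1 f (scale2 c w))) = scale2 c (f (\<rho>1 \<phi> (inv_into W1 f w)))"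
      unfolding W2 using inv inv_scale M1.scale_right scale by auto
  next
    fix \<phi> \<psi> w assume "\<phi> \<in> sl4" "\<psi> \<in> sl4" "w \<in> W2"
    then show "f (\<rho>1 (\<phi> + \<psi>) (inv_into W1 f w))
        = f (\<rho>1 \<phi> (inv_into W1 f w)) + f (\<rho>1 \<psi> (inv_into W1 f w))"
      unfolding W2 using inv M1.add_left add by auto
  next
    fix \<phi> w c assume "\<phi> \<in> sl4" "w \<in> W2"
    then show "f (\<rho>1 (mat_scale c \<phi>) (inv_into W1 f w)) = scale2 c (f (\<rho>1 \<phi> (inv_into W1 f w)))"
      unfolding W2 using inv M1.scale_left scale by auto
  next
    fix \<phi> \<psi> w assume "\<phi> \<in> sl4" "\<psi> \<in> sl4" "w \<in> W2"
    then show "f (\<rho>1 (lie_bracket \<phi> \<psi>) (inv_into W1 f w))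
        = f (\<rho>1 \<phi> (inv_into W1 f (f (\<rho>1 \<psi> (inv_into W1 f w)))))
        - f (\<rho>1 \<psi> (inv_into W1 f (f (\<rho>1 \<phi> (inv_into W1 f w)))))"
      unfolding W2 using inv M1.bracket M1.closed diff by auto
  qed
qed

section \<open>The module of homogeneous polynomials\<close>

definition deg :: "(4 \<Rightarrow>\<^sub>0 nat) \<Rightarrow> nat"
  where "deg m = (\<Sum>b\<in>UNIV. lookup m b)"

lemma deg_add [simp]: "deg (m + n) = deg m + deg n"
  by (simp add: deg_def lookup_add sum.distrib)

lemma deg_single [simp]: "deg (single b k) = k"
  by (simp add: deg_def lookup_single when_def)

lemma homog_iff: "p \<in> homog N \<longleftrightarrow> (\<forall>m. lookup p m \<noteq> 0 \<longrightarrow> deg m = N)"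
  by (auto simp: homog_def deg_def in_keys_iff)

text \<open>The effect on exponents of replacing one variable \<open>a\<close> by \<open>b\<close>.
  Subtraction truncates, so this is the intended vector only if \<open>lookup m a > 0\<close>;
  \<open>split_off\<close> then writes \<open>m\<close> as \<open>single a 1 + m'\<close>.\<close>

definition move :: "4 \<Rightarrow> 4 \<Rightarrow> (4 \<Rightarrow>\<^sub>0 nat) \<Rightarrow> (4 \<Rightarrow>\<^sub>0 nat)"
  where "move a b m = m - single a 1 + single b 1"

lemma move_cancel [simp]: "move a b (single a (Suc 0) + m) = single b (Suc 0) + m"
  by (simp add: move_def add.commute)

lemma split_off:
  fixes m :: "4 \<Rightarrow>\<^sub>0 nat"
  assumes "lookup m b > 0"
  obtains m' where "m = single b 1 + m'"
proof
  show "m = single b 1 + (m - single b 1)"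
    using assms by (intro poly_mapping_eqI) (auto simp: lookup_add lookup_minus lookup_single when_def)
qed

text \<open>Replacements in opposite directions are mutually inverse. This finds the only monomial
  from which a given one can arise.\<close>

lemma move_eq_iff:
  assumes "lookup n b > 0"
  shows "move b a n = m \<longleftrightarrow> lookup m a > 0 \<and> n = move a b m"
proof -
  obtain n' where n: "n = single b 1 + n'" using assms by (rule split_off)
  show ?thesis
  proof
    show "lookup m a > 0 \<and> n = move a b m" if "move b a n = m"
      using that by (auto simp: n lookup_add)
    show "move b a n = m" if *: "lookup m a > 0 \<and> n = move a b m"
    proof -
      obtain m' where m: "m = single a 1 + m'" using * by (blast elim: split_off)
      show ?thesis using * by (simp add: n m)
    qed
  qed
qed

lemma deg_move [simp]:
  assumes "lookup m a > 0"
  shows "deg (move a b m) = deg m"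
proof -
  obtain m' where "m = single a 1 + m'" using assms by (rule split_off)
  then show ?thesis by simp
qed

lemma poly_act_eq:
  "poly_act \<phi> = lin_ext (\<lambda>m. \<Sum>b\<in>UNIV. \<Sum>a\<in>UNIV. single (move b a m) (\<phi> $ a $ b * of_nat (lookup m b)))"
  unfolding move_def using acts_by_poly_act[of \<phi>] acts_by_exists[of \<phi>]
  by (auto simp: acts_by_def intro!: derivation_unique)

text \<open>The matrix unit at (a, b) acts as x_a d/dx_b, so it reaches \<open>m\<close> only from
  \<open>move a b m\<close>, and only if x_a divides \<open>m\<close>. The guard excludes the
  truncated case.\<close>

lemma lookup_poly_act:
  "lookup (poly_act \<phi> p) m = (\<Sum>a\<in>UNIV. \<Sum>b\<in>UNIV.
     if lookup m a = 0 then 0 else \<phi> $ a $ b * of_nat (lookup (move a b m) b) * lookup p (move a b m))"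
proof -
  have *: "(\<Sum>n\<in>keys p. lookup p n * (\<phi> $ a $ b * of_nat (lookup n b) when move b a n = m))
      = (if lookup m a = 0 then 0 else \<phi> $ a $ b * of_nat (lookup (move a b m) b) * lookup p (move a b m))"
    for a b
  proof -
    have "lookup p n * (\<phi> $ a $ b * of_nat (lookup n b) when move b a n = m)
        = (if n = move a b m then if lookup m a = 0 then 0
           else \<phi> $ a $ b * of_nat (lookup (move a b m) b) * lookup p (move a b m) else 0)" for n
      using move_eq_iff[of n b a m] by (cases "lookup n b = 0") (auto simp: when_def)
    then show ?thesis by (auto simp: in_keys_iff)
  qed
  have "lookup (poly_act \<phi> p) m = (\<Sum>b\<in>UNIV. \<Sum>a\<in>UNIV. \<Sum>n\<in>keys p.
      lookup p n * (\<phi> $ a $ b * of_nat (lookup n b) when move b a n = m))"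
    unfolding poly_act_eq
    by (subst sum.swap[of _ "keys p"] | simp add: lin_ext_def lookup_sum lookup_single sum_distrib_left)+
  also have "\<dots> = (\<Sum>a\<in>UNIV. \<Sum>b\<in>UNIV. \<Sum>n\<in>keys p.
      lookup p n * (\<phi> $ a $ b * of_nat (lookup n b) when move b a n = m))"
    by (rule sum.swap)
  finally show ?thesis unfolding * .
qed

lemma poly_act_homog: "p \<in> homog N \<Longrightarrow> poly_act \<phi> p \<in> homog N"
  unfolding homog_iff
proof (intro allI impI)
  fix m assume p: "\<forall>m. lookup p m \<noteq> 0 \<longrightarrow> deg m = N" and "lookup (poly_act \<phi> p) m \<noteq> 0"
  then obtain a b where "lookup m a > 0" "lookup p (move a b m) \<noteq> 0"
    unfolding lookup_poly_act by (auto elim!: sum.not_neutral_contains_not_neutral split: if_splits)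
  with p show "deg m = N" by (metis deg_move)
qed

lemma poly_act_derivation: "derivation (poly_act \<phi>)"
  and poly_act_pvar: "poly_act \<phi> (pvar b) = (\<Sum>a\<in>UNIV. \<phi> $ a $ b \<odot> pvar a)"
  using acts_by_poly_act[of \<phi>] by (auto simp: acts_by_def)

lemma poly_act_linear: "Vector_Spaces.linear pscale pscale (poly_act \<phi>)"
  using poly_act_derivation by (simp add: derivation_def)

lemma poly_act_Leibniz: "poly_act \<phi> (p * q) = poly_act \<phi> p * q + p * poly_act \<phi> q"
  using poly_act_derivation by (simp add: derivation_def)

text \<open>A commutator of derivations is a derivation, since the mixed Leibniz terms cancel. By
  \<open>derivation_unique\<close> a comparison on the variables suffices, and there composing
  actions multiplies matrices.\<close>

lemma poly_act_lie_bracket: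
  "poly_act (lie_bracket \<phi> \<psi>) p = poly_act \<phi> (poly_act \<psi> p) - poly_act \<psi> (poly_act \<phi> p)"
proof -
  interpret phi: Vector_Spaces.linear pscale pscale "poly_act \<phi>" by (rule poly_act_linear)
  interpret psi: Vector_Spaces.linear pscale pscale "poly_act \<psi>" by (rule poly_act_linear)
  have "poly_act (lie_bracket \<phi> \<psi>) = (\<lambda>p. poly_act \<phi> (poly_act \<psi> p) - poly_act \<psi> (poly_act \<phi> p))"
  proof (rule derivation_unique)
    show "derivation (\<lambda>p. poly_act \<phi> (poly_act \<psi> p) - poly_act \<psi> (poly_act \<phi> p))"
      by (simp add: derivation_def Vector_Spaces.linear_iff pscale.vector_space_axioms phi.add psi.add
          phi.scale psi.scale poly_act_Leibniz pscale.scale_right_diff_distrib) (simp add: algebra_simps)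
    have "poly_act \<phi> (poly_act \<psi> (pvar b)) = (\<Sum>c\<in>UNIV. (\<phi> ** \<psi>) $ c $ b \<odot> pvar c)" for \<phi> \<psi> b
    proof -
      interpret Vector_Spaces.linear pscale pscale "poly_act \<phi>" by (rule poly_act_linear)
      have "poly_act \<phi> (poly_act \<psi> (pvar b)) = (\<Sum>a\<in>UNIV. \<Sum>c\<in>UNIV. (\<phi> $ c $ a * \<psi> $ a $ b) \<odot> pvar c)"
        by (simp add: poly_act_pvar sum scale pscale.scale_sum_right mult.commute)
      also have "\<dots> = (\<Sum>c\<in>UNIV. \<Sum>a\<in>UNIV. (\<phi> $ c $ a * \<psi> $ a $ b) \<odot> pvar c)"
        by (rule sum.swap)
      finally show ?thesis by (simp add: matrix_matrix_mult_def pscale.scale_sum_left)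
    qed
    then show "poly_act (lie_bracket \<phi> \<psi>) (pvar b)
        = poly_act \<phi> (poly_act \<psi> (pvar b)) - poly_act \<psi> (poly_act \<phi> (pvar b))" for b
      by (simp add: poly_act_pvar[of "\<phi> ** \<psi> - \<psi> ** \<phi>"] lie_bracket_def
          pscale.scale_left_diff_distrib sum_subtractf)
  qed (rule poly_act_derivation)
  then show ?thesis by simp
qed

lemma sl4_module_homog: "sl4_module pscale (homog N) poly_act"
proof (intro sl4_module.intro sl4_module_axioms.intro pscale.vector_space_axioms)
  show "pscale.subspace (homog N)"
    by (rule pscale.subspaceI) (auto simp: homog_iff lookup_add, metis add_0)
qed (auto simp: poly_act_homog poly_act_lie_bracket
    module_hom.add[OF Vector_Spaces.linear.axioms(3)[OF poly_act_linear]]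
    module_hom.scale[OF Vector_Spaces.linear.axioms(3)[OF poly_act_linear]]
    lookup_poly_act lookup_add sum_distrib_left intro!: poly_mapping_eqI
    simp flip: sum.distrib intro!: sum.cong simp: algebra_simps)

section \<open>Profiles of triples of vertices\<close>

type_synonym triple = "vertex \<times> vertex \<times> vertex"

definition cube3 :: "nat \<Rightarrow> triple set"
  where "cube3 N = cube N \<times> cube N \<times> cube N"

text \<open>
  \<open>ctype i q\<close> tells which component of the triple \<open>q\<close> is the odd one out at coordinate \<open>i\<close>, and
  \<open>prof\<close> is the profile as the exponent vector of a monomial.
\<close>

definition ctype :: "nat \<Rightarrow> triple \<Rightarrow> 4"
  where "ctype i = (\<lambda>(x, y, z).
    if x i = y i then if y i = z i then 1 else 4 else if y i = z i then 2 else 3)"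

definition prof :: "nat \<Rightarrow> triple \<Rightarrow> (4 \<Rightarrow>\<^sub>0 nat)"
  where "prof N q = (\<Sum>i<N. single (ctype i q) 1)"

lemma cube_sign: "x \<in> cube N \<Longrightarrow> i < N \<Longrightarrow> x i = 1 \<or> x i = -1"
  by (auto simp: cube_def)

lemma finite_cube [simp]: "finite (cube N)"
  by (simp add: cube_def finite_PiE)

lemma finite_cube3 [simp]: "finite (cube3 N)"
  by (simp add: cube3_def)

lemma deg_prof [simp]: "deg (prof N q) = N"
  by (simp add: prof_def deg_def lookup_sum sum.swap[of _ "{..<N}"] lookup_single when_def)

lemma lookup_prof: "lookup (prof N q) b = card {i \<in> {..<N}. ctype i q = b}"
  by (simp add: prof_def lookup_sum lookup_single when_def flip: sum.inter_filter)

lemma poly_mapping_4_eqI: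
  "lookup m 1 = lookup n 1 \<Longrightarrow> lookup m 2 = lookup n 2 \<Longrightarrow> lookup m 3 = lookup n 3
    \<Longrightarrow> lookup m 4 = lookup n 4 \<Longrightarrow> m = n" for m n :: "4 \<Rightarrow>\<^sub>0 'a::zero"
  by (rule poly_mapping_eqI) (metis exhaust_4)

lemma profile_eq:
  assumes "(x, y, z) \<in> cube3 N"
  shows "profile N x y z = (lookup (prof N (x, y, z)) 1, lookup (prof N (x, y, z)) 2,
    lookup (prof N (x, y, z)) 3, lookup (prof N (x, y, z)) 4)"
proof -
  \<comment> \<open>With only two possible values, two disagreements force the third pair to agree;
    so the last branch of \<open>ctype\<close> matches the third entry of the profile.\<close>
  have "z i = x i" if "i < N" "x i \<noteq> y i" "y i \<noteq> z i" for i
    using assms that cube_sign[of x N i] cube_sign[of y N i] cube_sign[of z N i]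
    by (auto simp: cube3_def)
  then show ?thesis
    unfolding profile_def lookup_prof prod.inject
    by (intro conjI arg_cong[of _ _ card]) (auto simp: ctype_def)
qed

lemma sum_ctype:
  "(\<Sum>i<N. f (ctype i q)) = (\<Sum>a\<in>UNIV. of_nat (lookup (prof N q) a) * f a)" for f :: "4 \<Rightarrow> complex"
proof -
  have "(\<Sum>a\<in>UNIV. of_nat (lookup (prof N q) a) * f a)
      = (\<Sum>a\<in>UNIV. \<Sum>i | i \<in> {..<N} \<and> ctype i q = a. f (ctype i q))"
    by (simp add: lookup_prof)
  also have "\<dots> = (\<Sum>i<N. f (ctype i q))"
    by (rule sum.group) auto
  finally show ?thesis by simp
qed

text \<open>The profile is a sum over coordinates, and only the summand at \<open>j\<close> changes.
  That summand also makes the exponent of \<open>ctype j q\<close> positive, so \<open>move\<close>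
  does not truncate.\<close>

lemma prof_change:
  assumes "j < N" "\<And>i. i < N \<Longrightarrow> i \<noteq> j \<Longrightarrow> ctype i q' = ctype i q"
  shows "prof N q' = move (ctype j q) (ctype j q') (prof N q)"
proof -
  have split: "prof N q = single (ctype j q) (Suc 0) + (\<Sum>i\<in>{..<N} - {j}. single (ctype i q) 1)" for q
    unfolding prof_def using assms(1) by (subst sum.remove[of _ j]) auto
  have "(\<Sum>i\<in>{..<N} - {j}. single (ctype i q') 1) = (\<Sum>i\<in>{..<N} - {j}. single (ctype i q) (1::nat))"
    using assms(2) by (intro sum.cong) auto
  then show ?thesis by (simp add: split)
qed

lemma type_function_exists:
  "deg m = N \<Longrightarrow> \<exists>f. m = (\<Sum>i<N. single (f i) 1)"
proof (induction N arbitrary: m)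
  case 0
  then have "m = 0" by (intro poly_mapping_eqI) (simp add: deg_def)
  then show ?case by simp
next
  case (Suc N)
  then obtain b where "lookup m b > 0"
    unfolding deg_def by (metis gr0I nat.distinct(1) sum.neutral)
  then obtain m' where m: "m = single b 1 + m'" by (rule split_off)
  with Suc obtain f where "m' = (\<Sum>i<N. single (f i) 1)" by auto
  then have "m = (\<Sum>i<Suc N. single ((f(N := b)) i) 1)"
    by (simp add: m add.commute)
  then show ?case by blast
qed

lemma prof_surj:
  assumes "deg m = N"
  obtains q where "q \<in> cube3 N" "prof N q = m"
proof -
  obtain f where m: "m = (\<Sum>i<N. single (f i) 1)" using type_function_exists[OF assms] ..
  \<comment> \<open>Component \<open>c\<close> gets -1 exactly at the coordinates of type
    \<open>c\<close>; at type 1 all three components are 1.\<close>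
  define v :: "4 \<Rightarrow> vertex" where "v c = (\<lambda>i\<in>{..<N}. if f i = c then -1 else 1)" for c
  have "ctype i (v 2, v 3, v 4) = f i" if "i < N" for i
    using exhaust_4[of "f i"] that by (auto simp: ctype_def v_def)
  then have "prof N (v 2, v 3, v 4) = m" by (simp add: prof_def m)
  moreover have "(v 2, v 3, v 4) \<in> cube3 N" by (auto simp: cube3_def cube_def v_def)
  ultimately show ?thesis using that by blast
qed

section \<open>The fixed space\<close>

text \<open>An automorphism preserves walks of each length in both directions; surjectivity lets an
  intermediate vertex be written as \<open>g z\<close>.\<close>

lemma path_dist_Aut:
  assumes g: "g \<in> Aut N" and "x \<in> cube N" "y \<in> cube N"
  shows "path_dist N (g x) (g y) = path_dist N x y"
proof -
  have perm: "g permutes cube N" and adj: "\<And>x y. x \<in> cube N \<Longrightarrow> y \<in> cube N \<Longrightarrow> (g x, g y) \<in> adj N \<longleftrightarrow> (x, y) \<in> adj N"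
    using g by (auto simp: Aut_def)
  have cube: "g x \<in> cube N \<longleftrightarrow> x \<in> cube N" for x using perm by (simp add: permutes_in_image)
  have adj_cube: "x \<in> cube N" "y \<in> cube N" if "(x, y) \<in> adj N" for x y
    using that by (auto simp: adj_def)
  have "(g x, g y) \<in> adj N ^^ n \<longleftrightarrow> (x, y) \<in> adj N ^^ n" if "y \<in> cube N" for n y
    using that
  proof (induction n arbitrary: y)
    case 0
    show ?case using permutes_inj[OF perm] by (auto dest: injD)
  next
    case (Suc n)
    have "(g x, g y) \<in> adj N ^^ Suc n \<longleftrightarrow> (\<exists>z. (g x, g z) \<in> adj N ^^ n \<and> (g z, g y) \<in> adj N)"
      using permutes_surj[OF perm] by (auto simp: relcomp.simps) (metis surjD)
    also have "\<dots> \<longleftrightarrow> (\<exists>z. (x, z) \<in> adj N ^^ n \<and> (z, y) \<in> adj N)"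
      using Suc adj adj_cube cube by metis
    finally show ?case by (auto simp: relcomp.simps)
  qed
  then show ?thesis using assms by (simp add: path_dist_def)
qed

lemma card_two_types:
  assumes "\<And>i. i < N \<Longrightarrow> P i \<longleftrightarrow> ctype i q \<in> {a, b}" "a \<noteq> b"
  shows "card {i \<in> {..<N}. P i} = lookup (prof N q) a + lookup (prof N q) b"
proof -
  have "{i \<in> {..<N}. P i} = {i \<in> {..<N}. ctype i q = a} \<union> {i \<in> {..<N}. ctype i q = b}"
    using assms by auto
  also have "card \<dots> = lookup (prof N q) a + lookup (prof N q) b"
    unfolding lookup_prof using assms(2) by (intro card_Un_disjoint) auto
  finally show ?thesis .
qed

lemma ctype_iff:
  assumes "(x, y, z) \<in> cube3 N" "i < N"
  shows "x i \<noteq> y i \<longleftrightarrow> ctype i (x, y, z) \<in> {2, 3}"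
    and "y i \<noteq> z i \<longleftrightarrow> ctype i (x, y, z) \<in> {3, 4}"
    and "z i \<noteq> x i \<longleftrightarrow> ctype i (x, y, z) \<in> {2, 4}"
proof -
  have "x i = 1 \<or> x i = -1" "y i = 1 \<or> y i = -1" "z i = 1 \<or> z i = -1"
    using assms by (auto simp: cube3_def cube_def)
  then show "x i \<noteq> y i \<longleftrightarrow> ctype i (x, y, z) \<in> {2, 3}" "y i \<noteq> z i \<longleftrightarrow> ctype i (x, y, z) \<in> {3, 4}"
    "z i \<noteq> x i \<longleftrightarrow> ctype i (x, y, z) \<in> {2, 4}"
    by (auto simp: ctype_def)
qed

lemma path_dist_prof:
  assumes "(x, y, z) \<in> cube3 N"
  shows "path_dist N x y = lookup (prof N (x, y, z)) 2 + lookup (prof N (x, y, z)) 3"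
    and "path_dist N y z = lookup (prof N (x, y, z)) 3 + lookup (prof N (x, y, z)) 4"
    and "path_dist N z x = lookup (prof N (x, y, z)) 2 + lookup (prof N (x, y, z)) 4"
proof -
  note * = ctype_iff[OF assms]
  show "path_dist N x y = lookup (prof N (x, y, z)) 2 + lookup (prof N (x, y, z)) 3"
    "path_dist N y z = lookup (prof N (x, y, z)) 3 + lookup (prof N (x, y, z)) 4"
    "path_dist N z x = lookup (prof N (x, y, z)) 2 + lookup (prof N (x, y, z)) 4"
    using assms card_two_types[OF *(1)] card_two_types[OF *(2)] card_two_types[OF *(3)]
    by (simp_all add: cube3_def path_dist_eq_card)
qed

definition gmap :: "(vertex \<Rightarrow> vertex) \<Rightarrow> triple \<Rightarrow> triple"
  where "gmap g = (\<lambda>(x, y, z). (g x, g y, g z))"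

text \<open>The three preserved distances are the pairwise sums of entries 2, 3, 4 of the profile
  and so determine these entries; entry 1 follows from the total \<open>N\<close>.\<close>

lemma prof_Aut:
  assumes g: "g \<in> Aut N" and q: "q \<in> cube3 N"
  shows "prof N (gmap g q) = prof N q"
proof -
  obtain x y z where [simp]: "q = (x, y, z)" by (cases q)
  have "g permutes cube N" using g by (simp add: Aut_def)
  then have q': "(g x, g y, g z) \<in> cube3 N"
    using q by (simp add: cube3_def permutes_in_image)
  let ?m = "prof N q" and ?m' = "prof N (gmap g q)"
  have "lookup ?m' 2 + lookup ?m' 3 = lookup ?m 2 + lookup ?m 3"
    "lookup ?m' 3 + lookup ?m' 4 = lookup ?m 3 + lookup ?m 4"
    "lookup ?m' 2 + lookup ?m' 4 = lookup ?m 2 + lookup ?m 4"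
    using path_dist_prof[of x y z N] path_dist_prof[OF q'] path_dist_Aut[OF g] q
    by (simp_all add: cube3_def gmap_def)
  moreover have "deg ?m' = deg ?m" by simp
  ultimately show ?thesis
    by (intro poly_mapping_4_eqI) (simp_all add: deg_def sum_4)
qed

text \<open>
  Permuting coordinates aligns the types of two triples with equal profiles; sign changes
  then align the first components, hence all three.
\<close>

lemma Aut_transitive:
  assumes q: "q \<in> cube3 N" and q': "q' \<in> cube3 N" and eq: "prof N q = prof N q'"
  obtains g where "g \<in> Aut N" "gmap g q = q'"
proof -
  obtain x y z where [simp]: "q = (x, y, z)" by (cases q)
  obtain x' y' z' where [simp]: "q' = (x', y', z')" by (cases q')
  \<comment> \<open>Equal profiles mean that each type occurs equally often, which yields a
    permutation matching the types.\<close>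
  have "image_mset (\<lambda>i. ctype i q') (mset_set {..<N}) = image_mset (\<lambda>i. ctype i q) (mset_set {..<N})"
    using arg_cong[OF eq, of lookup]
    by (intro multiset_eqI) (auto simp: fun_eq_iff lookup_prof count_image_mset_eq_card_vimage conj_commute vimage_def
        Collect_conj_eq)
  then obtain \<pi> where \<pi>: "\<pi> permutes {..<N}" and type: "\<forall>i\<in>{..<N}. ctype i q' = ctype (\<pi> i) q"
    using image_mset_eq_implies_permutes[of "{..<N}"] by blast
  have \<pi>_less: "\<pi> i < N \<longleftrightarrow> i < N" for i using permutes_in_image[OF \<pi>] by auto
  \<comment> \<open>The sign \<open>x' i * x (\<pi> i)\<close> is chosen so that
    \<open>g x = x'\<close>, because a sign squares to 1. Off the cube \<open>g\<close> is the
    identity, as \<open>permutes\<close> demands.\<close>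
  define g where "g v = (if v \<in> cube N then \<lambda>i\<in>{..<N}. x' i * x (\<pi> i) * v (\<pi> i) else v)" for v
  have xc: "x \<in> cube N" "y \<in> cube N" "z \<in> cube N" "x' \<in> cube N" "y' \<in> cube N" "z' \<in> cube N"
    using q q' by (auto simp: cube3_def)
  have g_cube: "g v \<in> cube N" if "v \<in> cube N" for v
  proof -
    have "x' i * x (\<pi> i) * v (\<pi> i) \<in> {1, -1}" if "i < N" for i
    proof -
      have "\<pi> i < N" using that \<pi>_less by simp
      from cube_sign[OF \<open>v \<in> cube N\<close> this] cube_sign[OF xc(1) this] cube_sign[OF xc(4) that] show ?thesis
        by (elim disjE) simp_all
    qed
    then show ?thesis using that by (auto simp: g_def cube_def)
  qed
  \<comment> \<open>Both vertices are multiplied by the same nonzero sign at \<open>i\<close>, so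
    disagreements are only moved by \<open>\<pi>\<close>.\<close>
  have neq: "g v i \<noteq> g w i \<longleftrightarrow> v (\<pi> i) \<noteq> w (\<pi> i)" if "v \<in> cube N" "w \<in> cube N" "i < N" for v w i
  proof -
    have "\<pi> i < N" using that \<pi>_less by simp
    then have "x' i * x (\<pi> i) \<noteq> 0" using cube_sign[OF xc(1), of "\<pi> i"] cube_sign[OF xc(4), of i] that by auto
    then show ?thesis using that by (simp add: g_def)
  qed
  have diff: "card {i \<in> {..<N}. g v i \<noteq> g w i} = card {i \<in> {..<N}. v i \<noteq> w i}"
    if "v \<in> cube N" "w \<in> cube N" for v w
  proof -
    have "\<pi> ` {i \<in> {..<N}. g v i \<noteq> g w i} = {i \<in> {..<N}. v i \<noteq> w i}"
    proof (intro equalityI subsetI)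
      fix j assume j: "j \<in> {i \<in> {..<N}. v i \<noteq> w i}"
      obtain i where "j = \<pi> i" using permutes_surj[OF \<pi>] by (metis surjD)
      with j show "j \<in> \<pi> ` {i \<in> {..<N}. g v i \<noteq> g w i}" using neq[OF that, of i] \<pi>_less[of i] by auto
    next
      fix j assume "j \<in> \<pi> ` {i \<in> {..<N}. g v i \<noteq> g w i}"
      then show "j \<in> {i \<in> {..<N}. v i \<noteq> w i}" by (auto simp: neq[OF that] \<pi>_less)
    qed
    then have "bij_betw \<pi> {i \<in> {..<N}. g v i \<noteq> g w i} {i \<in> {..<N}. v i \<noteq> w i}"
      by (rule bij_betw_subset[OF permutes_imp_bij[OF \<pi>], rotated]) auto
    then show ?thesis by (rule bij_betw_same_card)
  qed
  have "inj_on g (cube N)"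
  proof (rule inj_onI)
    fix v w assume *: "v \<in> cube N" "w \<in> cube N" "g v = g w"
    then have "{i \<in> {..<N}. v i \<noteq> w i} = {}" using diff[of v w] by simp
    then show "v = w" using * by (intro PiE_ext[of v "{..<N}" _ w]) (auto simp: cube_def)
  qed
  then have "g permutes cube N"
    by (rule inj_imp_permutes) (auto simp: g_cube, simp add: g_def)
  then have "g \<in> Aut N" using diff by (simp add: Aut_def adj_def g_cube)
  moreover have "g x = x'" "g y = y'" "g z = z'"
  proof -
    have "g x i = x' i \<and> g y i = y' i \<and> g z i = z' i" if "i < N" for i
    proof -
      have \<pi>i: "\<pi> i < N" using that \<pi>_less by simp
      \<comment> \<open>A sign is determined by whether it agrees with the first component, so
        matching types force \<open>y\<close> and \<open>z\<close> to go to \<open>y'\<close> and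
        \<open>z'\<close>.\<close>
      have sgn: "g w i = w' i" if "w \<in> cube N" "w' \<in> cube N" "w (\<pi> i) \<noteq> x (\<pi> i) \<longleftrightarrow> w' i \<noteq> x' i" for w w'
        using cube_sign[OF that(1) \<pi>i] cube_sign[OF that(2) \<open>i < N\<close>] cube_sign[OF xc(1) \<pi>i] cube_sign[OF xc(4) \<open>i < N\<close>]
          that(1,3) \<open>i < N\<close> by (elim disjE) (simp_all add: g_def)
      have "x (\<pi> i) \<noteq> y (\<pi> i) \<longleftrightarrow> x' i \<noteq> y' i" "z (\<pi> i) \<noteq> x (\<pi> i) \<longleftrightarrow> z' i \<noteq> x' i"
        using ctype_iff[of x y z N "\<pi> i"] ctype_iff[of x' y' z' N i] bspec[OF type, of i] q q' that \<pi>i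
        by simp_all
      then show ?thesis using xc by (intro conjI sgn) auto
    qed
    then show "g x = x'" "g y = y'" "g z = z'"
      using g_cube xc by (auto intro!: PiE_ext[of _ "{..<N}" "\<lambda>_. {1, -1}"] simp: cube_def)
  qed
  ultimately show ?thesis using that by (auto simp: gmap_def)
qed

lemma lookup_act3:
  assumes "inj g"
  shows "lookup (act3 g v) (gmap g q) = lookup v q"
proof -
  have "act3 g = lin_ext (\<lambda>q. single (gmap g q) 1)"
    unfolding act3_def tens_def gmap_def by (intro arg_cong[of _ _ lin_ext]) auto
  moreover have "gmap g b = gmap g q \<longleftrightarrow> b = q" for b
    using assms by (cases b; cases q) (auto simp: gmap_def dest: injD)
  ultimately show ?thesis
    by (simp add: lin_ext_def lookup_sum lookup_single when_def in_keys_iff)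
qed

text \<open>A vector is fixed iff its coefficients are constant on orbits, and by
  \<open>prof_Aut\<close> and \<open>Aut_transitive\<close> the orbits on \<open>cube3 N\<close> are
  the profile classes.\<close>

lemma FixG_iff:
  "v \<in> FixG N \<longleftrightarrow> (\<forall>q. q \<notin> cube3 N \<longrightarrow> lookup v q = 0) \<and>
    (\<forall>q\<in>cube3 N. \<forall>q'\<in>cube3 N. prof N q = prof N q' \<longrightarrow> lookup v q = lookup v q')"
  (is "_ \<longleftrightarrow> ?V \<and> ?P")
proof -
  have V: "v \<in> V3 N \<longleftrightarrow> ?V" by (auto simp: V3_def cube3_def in_keys_iff)
  have "(\<forall>g\<in>Aut N. act3 g v = v) \<longleftrightarrow> ?P" if ?V
  proof
    assume *: "\<forall>g\<in>Aut N. act3 g v = v"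
    show ?P
    proof (intro ballI impI)
      fix q q' assume "q \<in> cube3 N" "q' \<in> cube3 N" "prof N q = prof N q'"
      then obtain g where g: "g \<in> Aut N" "gmap g q = q'" by (rule Aut_transitive)
      then have "inj g" by (auto simp: Aut_def permutes_inj)
      then show "lookup v q = lookup v q'" using lookup_act3[of g v q] * g by simp
    qed
  next
    assume P: ?P
    show "\<forall>g\<in>Aut N. act3 g v = v"
    proof (intro ballI poly_mapping_eqI)
      fix g q' assume g: "g \<in> Aut N"
      then have perm: "g permutes cube N" by (simp add: Aut_def)
      have "surj (gmap g)"
        using permutes_surj[OF perm] by (force simp: gmap_def surj_def)
      then obtain q where q': "q' = gmap g q" by (metis surjD)
      have "gmap g q \<in> cube3 N \<longleftrightarrow> q \<in> cube3 N"
        using perm by (auto simp: cube3_def gmap_def permutes_in_image split: prod.splits)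
      then have "lookup v q = lookup v (gmap g q)"
      proof (cases "q \<in> cube3 N")
        case True
        with \<open>gmap g q \<in> cube3 N \<longleftrightarrow> q \<in> cube3 N\<close> show ?thesis using P prof_Aut[OF g] by metis
      next
        case False
        with \<open>gmap g q \<in> cube3 N \<longleftrightarrow> q \<in> cube3 N\<close> show ?thesis using \<open>?V\<close> by metis
      qed
      then show "lookup (act3 g v) q' = lookup v q'"
        using lookup_act3[OF permutes_inj[OF perm]] q' by simp
    qed
  qed
  then show ?thesis unfolding FixG_def mem_Collect_eq V by blast
qed

section \<open>The isomorphism\<close>

definition mfact :: "(4 \<Rightarrow>\<^sub>0 nat) \<Rightarrow> complex"
  where "mfact m = (\<Prod>b\<in>UNIV. fact (lookup m b))"

lemma mfact_nonzero [simp]: "mfact m \<noteq> 0"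
  by (simp add: mfact_def)

lemma mfact_add_single: "mfact (single b (Suc 0) + m) = of_nat (Suc (lookup m b)) * mfact m"
proof -
  have "mfact (single b (Suc 0) + m) = (\<Prod>c\<in>UNIV. (if c = b then of_nat (Suc (lookup m b)) else 1) * fact (lookup m c))"
    unfolding mfact_def by (intro prod.cong) (auto simp: lookup_add lookup_single when_def)
  then show ?thesis by (simp add: prod.distrib mfact_def)
qed

text \<open>With \<open>m = single a 1 + m'\<close>, both sides equal (m'_a + 1)(m'_b + 1) times
  \<open>mfact m'\<close>. The exponent produced by differentiation is thereby traded for the number
  of coordinates of type \<open>a\<close>.\<close>

lemma mfact_move:
  assumes "lookup m a > 0"
  shows "mfact m * of_nat (lookup (move a b m) b) = of_nat (lookup m a) * mfact (move a b m)"
proof -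
  obtain m' where "m = single a 1 + m'" using assms by (rule split_off)
  then show ?thesis by (simp add: mfact_add_single lookup_add)
qed

text \<open>The scaling in \<open>ddag\<close> combined with the denominator in
  \<open>B_tilde\<close>.\<close>

definition kappa :: "nat \<Rightarrow> complex"
  where "kappa N = of_real (sqrt (fact N * 2 ^ N)) / (fact N * 2 ^ N)"

lemma kappa_nonzero [simp]: "kappa N \<noteq> 0"
  by (simp add: kappa_def)

lemma lookup_B_sum:
  "lookup (B_sum N r s t u) q = (if q \<in> cube3 N \<and> lookup (prof N q) 1 = r \<and> lookup (prof N q) 2 = s
     \<and> lookup (prof N q) 3 = t \<and> lookup (prof N q) 4 = u then 1 else 0)"
proof -
  let ?S = "{(x, y, z) \<in> cube N \<times> cube N \<times> cube N. profile N x y z = (r, s, t, u)}"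
  have "finite ?S" by (rule finite_subset[of _ "cube3 N"]) (auto simp: cube3_def)
  then have "lookup (B_sum N r s t u) q = (if q \<in> ?S then 1 else 0)"
    unfolding B_sum_def tens_def case_prod_beta prod.collapse
    by (simp add: lookup_sum lookup_single when_def)
  moreover have "q \<in> ?S \<longleftrightarrow> q \<in> cube3 N \<and> lookup (prof N q) 1 = r \<and> lookup (prof N q) 2 = s
     \<and> lookup (prof N q) 3 = t \<and> lookup (prof N q) 4 = u"
    by (cases q) (auto simp: profile_eq cube3_def)
  ultimately show ?thesis by simp
qed

text \<open>The vectors \<open>B_sum\<close> are indicators of disjoint profile classes, so only the
  monomial with exponent \<open>prof N q\<close> contributes at \<open>q\<close>.\<close>

lemma lookup_ddag:
  "lookup (ddag N p) q = (if q \<in> cube3 N then kappa N * mfact (prof N q) * lookup p (prof N q) else 0)"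
proof -
  have mono: "lookup (of_real (sqrt (fact N * 2 ^ N)) \<odot>
      B_tilde N (lookup m 1) (lookup m 2) (lookup m 3) (lookup m 4)) q
      = (if m = prof N q then if q \<in> cube3 N then kappa N * mfact (prof N q) else 0 else 0)" for m
  proof -
    have eq: "lookup (prof N q) 1 = lookup m 1 \<and> lookup (prof N q) 2 = lookup m 2
      \<and> lookup (prof N q) 3 = lookup m 3 \<and> lookup (prof N q) 4 = lookup m 4 \<longleftrightarrow> m = prof N q"
      using poly_mapping_4_eqI[of m "prof N q"] by auto
    have arith: "s * (f / d * (if P then if Q then 1 else 0 else 0)) = (if P then if Q then s / d * f else 0 else 0)"
      for s f d :: complex and P Q by simp
    have mfact: "mfact m = fact (lookup m 1) * fact (lookup m 2) * fact (lookup m 3) * fact (lookup m 4)"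
      unfolding mfact_def UNIV_4 by (simp add: mult.assoc)
    have B: "lookup (B_sum N (lookup m 1) (lookup m 2) (lookup m 3) (lookup m 4)) q
        = (if m = prof N q then if q \<in> cube3 N then 1 else 0 else 0)"
      unfolding lookup_B_sum eq by simp
    show ?thesis
      unfolding B_tilde_def lookup_pscale B arith kappa_def mfact[symmetric] by simp
  qed
  show ?thesis
    unfolding ddag_def lin_ext_def lookup_sum lookup_pscale[of "lookup p _"] mono
    by (simp add: mult_delta_right in_keys_iff mult.commute)
qed

lemma ddag_add: "ddag N (p + p') = ddag N p + ddag N p'"
  by (simp add: ddag_def lin_ext_add)

lemma ddag_scale: "ddag N (c \<odot> p) = c \<odot> ddag N p"
  by (simp add: ddag_def lin_ext_scale)

text \<open>Injectivity holds since every exponent vector of degree \<open>N\<close> is a profile.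
  For surjectivity the coefficient of a fixed vector on each profile class is divided by the nonzero
  factor from \<open>lookup_ddag\<close>.\<close>

lemma bij_ddag: "bij_betw (ddag N) (homog N) (FixG N)"
  unfolding bij_betw_def
proof (intro conjI inj_onI equalityI subsetI)
  fix p p' assume p: "p \<in> homog N" "p' \<in> homog N" and eq: "ddag N p = ddag N p'"
  show "p = p'"
  proof (rule poly_mapping_eqI)
    fix m
    show "lookup p m = lookup p' m"
    proof (cases "deg m = N")
      case True
      then obtain q where "q \<in> cube3 N" "prof N q = m" by (rule prof_surj)
      then show ?thesis using arg_cong[OF eq, of "\<lambda>v. lookup v q"] by (simp add: lookup_ddag)
    next
      case False
      then show ?thesis using p unfolding homog_iff by metis
    qed
  qed
next
  fix v assume "v \<in> ddag N ` homog N"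
  then show "v \<in> FixG N" by (auto simp: FixG_iff lookup_ddag)
next
  fix v assume "v \<in> FixG N"
  then have out: "q \<notin> cube3 N \<Longrightarrow> lookup v q = 0"
    and const: "q \<in> cube3 N \<Longrightarrow> q' \<in> cube3 N \<Longrightarrow> prof N q = prof N q' \<Longrightarrow> lookup v q = lookup v q'" for q q'
    unfolding FixG_iff by metis+
  \<comment> \<open>Any triple of the given profile will do, because \<open>v\<close> is constant on
    profile classes.\<close>
  define rep where "rep m = (SOME q. q \<in> cube3 N \<and> prof N q = m)" for m
  have rep: "rep (prof N q) \<in> cube3 N" "prof N (rep (prof N q)) = prof N q" if "q \<in> cube3 N" for q
    using someI[of "\<lambda>q'. q' \<in> cube3 N \<and> prof N q' = prof N q" q] that by (auto simp: rep_def)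
  define p where "p = (\<Sum>m\<in>prof N ` cube3 N. single m (lookup v (rep m) / (kappa N * mfact m)))"
  have p: "lookup p m = (if m \<in> prof N ` cube3 N then lookup v (rep m) / (kappa N * mfact m) else 0)" for m
    by (simp add: p_def lookup_sum lookup_single when_def)
  have "p \<in> homog N" by (auto simp: homog_iff p split: if_splits)
  moreover have "v = ddag N p"
  proof (rule poly_mapping_eqI)
    fix q
    show "lookup v q = lookup (ddag N p) q"
    proof (cases "q \<in> cube3 N")
      case True
      then have "lookup v (rep (prof N q)) = lookup v q" by (intro const rep)
      then show ?thesis using True by (simp add: lookup_ddag p)
    qed (simp add: lookup_ddag out)
  qed
  ultimately show "v \<in> ddag N ` homog N" by blast
qed

text \<open>By \<open>mfact_move\<close> the terms of type \<open>a\<close> carry the weight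
  \<open>lookup (prof N q) a\<close>, and \<open>sum_ctype\<close> turns this weighted sum over
  types into a sum over coordinates.\<close>

lemma lookup_ddag_poly_act:
  assumes "q \<in> cube3 N"
  shows "lookup (ddag N (poly_act \<phi> p)) q = (\<Sum>i<N. \<Sum>b\<in>UNIV. \<phi> $ ctype i q $ b *
    (kappa N * mfact (move (ctype i q) b (prof N q)) * lookup p (move (ctype i q) b (prof N q))))"
proof -
  let ?m = "prof N q"
  have "lookup (ddag N (poly_act \<phi> p)) q = (\<Sum>a\<in>UNIV. \<Sum>b\<in>UNIV. kappa N * (mfact ?m * (if lookup ?m a = 0 then 0
      else \<phi> $ a $ b * of_nat (lookup (move a b ?m) b) * lookup p (move a b ?m))))"
    using assms by (simp add: lookup_ddag lookup_poly_act sum_distrib_left mult.assoc)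
  also have "\<dots> = (\<Sum>a\<in>UNIV. \<Sum>b\<in>UNIV. of_nat (lookup ?m a) *
      (\<phi> $ a $ b * (kappa N * mfact (move a b ?m) * lookup p (move a b ?m))))"
  proof (intro sum.cong refl)
    fix a b
    show "kappa N * (mfact ?m * (if lookup ?m a = 0 then 0
        else \<phi> $ a $ b * of_nat (lookup (move a b ?m) b) * lookup p (move a b ?m)))
      = of_nat (lookup ?m a) * (\<phi> $ a $ b * (kappa N * mfact (move a b ?m) * lookup p (move a b ?m)))"
    proof (cases "lookup ?m a = 0")
      case False
      then have eq: "mfact ?m * of_nat (lookup (move a b ?m) b) = of_nat (lookup ?m a) * mfact (move a b ?m)"
        by (intro mfact_move) simp
      have "c * (f * (x * l * y)) = (c * x * y) * (f * l)" for c f x l y :: complex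
        by (simp only: mult_ac)
      then show ?thesis using False by (simp only: if_False eq) (simp only: mult_ac)
    qed simp
  qed
  finally show ?thesis
    using sum_ctype[of "\<lambda>a. \<Sum>b\<in>UNIV. \<phi> $ a $ b *
        (kappa N * mfact (move a b ?m) * lookup p (move a b ?m))" q N]
    by (simp flip: sum_distrib_left)
qed

section \<open>Coordinates of the six maps on the tensor cube\<close>

definition flip :: "nat \<Rightarrow> vertex \<Rightarrow> vertex"
  where "flip i x = x(i := - x i)"

lemma flip_cube [simp]: "x \<in> cube N \<Longrightarrow> i < N \<Longrightarrow> flip i x \<in> cube N"
  by (auto simp: cube_def flip_def PiE_iff extensional_def)

lemma nbrs_eq:
  assumes "x \<in> cube N"
  shows "nbrs N x = (\<lambda>i. flip i x) ` {..<N}"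
proof (intro equalityI subsetI)
  fix y assume "y \<in> nbrs N x"
  then have y: "y \<in> cube N" and "card {i \<in> {..<N}. x i \<noteq> y i} = 1" by (auto simp: nbrs_def adj_def)
  then obtain i where i: "{i \<in> {..<N}. x i \<noteq> y i} = {i}" by (auto simp: card_1_singleton_iff)
  then have "i < N" "x i \<noteq> y i" by auto
  then have "y i = - x i" using cube_sign[OF assms \<open>i < N\<close>] cube_sign[OF y \<open>i < N\<close>] by auto
  moreover have "y j = x j" if "j < N" "j \<noteq> i" for j
  proof -
    have "j \<notin> {i \<in> {..<N}. x i \<noteq> y i}" unfolding i using that by simp
    then show ?thesis using that by simp
  qed
  ultimately have "y j = flip i x j" if "j < N" for j
    using that by (cases "j = i") (auto simp: flip_def)
  then have "y = flip i x"
    using y flip_cube[OF assms \<open>i < N\<close>] unfolding cube_def by (intro PiE_ext) auto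
  then show "y \<in> (\<lambda>i. flip i x) ` {..<N}" using \<open>i < N\<close> by auto
next
  fix y assume "y \<in> (\<lambda>i. flip i x) ` {..<N}"
  then obtain i where y: "y = flip i x" "i < N" by auto
  then have "x i \<noteq> - x i" using cube_sign[OF assms, of i] by auto
  then have "x j \<noteq> y j \<longleftrightarrow> j = i" for j using y by (simp add: flip_def)
  then have "{j \<in> {..<N}. x j \<noteq> y j} = {i}" using y by auto
  then show "y \<in> nbrs N x" using assms y by (simp add: nbrs_def adj_def)
qed

lemma sum_nbrs:
  assumes "x \<in> cube N"
  shows "(\<Sum>\<xi>\<in>nbrs N x. f \<xi>) = (\<Sum>i<N. f (flip i x))"
proof -
  have "inj_on (\<lambda>i. flip i x) {..<N}"
  proof (rule inj_onI)
    fix i j assume "i \<in> {..<N}" and eq: "flip i x = flip j x"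
    then have "x i \<noteq> - x i" using cube_sign[OF assms, of i] by auto
    with fun_cong[OF eq, of i] show "i = j" by (simp add: flip_def split: if_splits)
  qed
  then show ?thesis by (simp add: nbrs_eq[OF assms] sum.reindex)
qed

lemma finite_nbrs [simp]: "finite (nbrs N x)"
  by (rule finite_subset[of _ "cube N"]) (auto simp: nbrs_def adj_def)

lemma nbrs_sym: "x \<in> nbrs N x' \<longleftrightarrow> x' \<in> nbrs N x"
  by (auto simp: nbrs_def adj_def eq_commute)

text \<open>A symmetric relation gives a symmetric matrix, so the coefficient at \<open>q\<close>
  may be gathered over the elements related to \<open>q\<close> itself.\<close>

lemma lookup_lin_ext_symmetric:
  assumes fin: "\<And>q. finite (R q)" and sym: "\<And>q q'. q \<in> R q' \<longleftrightarrow> q' \<in> R q"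
  shows "lookup (lin_ext (\<lambda>q. \<Sum>q'\<in>R q. single q' 1) v) q = (\<Sum>q'\<in>R q. lookup v q')"
proof -
  have "lookup (lin_ext (\<lambda>q. \<Sum>q'\<in>R q. single q' 1) v) q = (\<Sum>b\<in>keys v. if q \<in> R b then lookup v b else 0)"
    by (auto simp: lin_ext_def lookup_sum lookup_single when_def fin intro!: sum.cong)
  also have "\<dots> = (\<Sum>b\<in>keys v. if b \<in> R q then lookup v b else 0)"
    using sym by simp
  also have "\<dots> = (\<Sum>b\<in>keys v \<inter> R q. lookup v b)"
    by (rule sum.inter_restrict[symmetric]) simp
  also have "\<dots> = (\<Sum>b\<in>R q. lookup v b)"
    using fin by (intro sum.mono_neutral_left) (auto simp: in_keys_iff)
  finally show ?thesis .
qed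

lemma lookup_Aup:
  assumes "x \<in> cube N" "y \<in> cube N" "z \<in> cube N"
  shows "lookup (Aup1 N v) (x, y, z) = (\<Sum>i<N. lookup v (flip i x, y, z))"
    and "lookup (Aup2 N v) (x, y, z) = (\<Sum>i<N. lookup v (x, flip i y, z))"
    and "lookup (Aup3 N v) (x, y, z) = (\<Sum>i<N. lookup v (x, y, flip i z))"
proof -
  \<comment> \<open>Changing one component to a neighbour is viewed as a symmetric relation on
    triples.\<close>
  have "Aup1 N v = lin_ext (\<lambda>q. \<Sum>q'\<in>(\<lambda>\<xi>. (\<xi>, snd q)) ` nbrs N (fst q). single q' 1) v"
    unfolding Aup1_def by (rule fun_cong[OF arg_cong[of _ _ lin_ext]])
      (auto simp: fun_eq_iff tens_def inj_on_def sum.reindex)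
  also have "lookup \<dots> (x, y, z) = (\<Sum>q'\<in>(\<lambda>\<xi>. (\<xi>, y, z)) ` nbrs N x. lookup v q')"
    by (subst lookup_lin_ext_symmetric) (auto simp: nbrs_sym)
  finally show "lookup (Aup1 N v) (x, y, z) = (\<Sum>i<N. lookup v (flip i x, y, z))"
    by (simp add: inj_on_def sum.reindex sum_nbrs assms)
  have "Aup2 N v = lin_ext (\<lambda>q. \<Sum>q'\<in>(\<lambda>\<xi>. (fst q, \<xi>, snd (snd q))) ` nbrs N (fst (snd q)). single q' 1) v"
    unfolding Aup2_def by (rule fun_cong[OF arg_cong[of _ _ lin_ext]])
      (auto simp: fun_eq_iff tens_def inj_on_def sum.reindex)
  also have "lookup \<dots> (x, y, z) = (\<Sum>q'\<in>(\<lambda>\<xi>. (x, \<xi>, z)) ` nbrs N y. lookup v q')"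
    by (subst lookup_lin_ext_symmetric) (auto simp: nbrs_sym)
  finally show "lookup (Aup2 N v) (x, y, z) = (\<Sum>i<N. lookup v (x, flip i y, z))"
    by (simp add: inj_on_def sum.reindex sum_nbrs assms)
  have "Aup3 N v = lin_ext (\<lambda>q. \<Sum>q'\<in>(\<lambda>\<xi>. (fst q, fst (snd q), \<xi>)) ` nbrs N (snd (snd q)). single q' 1) v"
    unfolding Aup3_def by (rule fun_cong[OF arg_cong[of _ _ lin_ext]])
      (auto simp: fun_eq_iff tens_def inj_on_def sum.reindex)
  also have "lookup \<dots> (x, y, z) = (\<Sum>q'\<in>(\<lambda>\<xi>. (x, y, \<xi>)) ` nbrs N z. lookup v q')"
    by (subst lookup_lin_ext_symmetric) (auto simp: nbrs_sym)
  finally show "lookup (Aup3 N v) (x, y, z) = (\<Sum>i<N. lookup v (x, y, flip i z))"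
    by (simp add: inj_on_def sum.reindex sum_nbrs assms)
qed

lemma lookup_diagonal:
  "lookup (lin_ext (\<lambda>(x, y, z). c x y z \<odot> tens x y z) v) (x, y, z) = c x y z * lookup v (x, y, z)"
proof -
  have "lookup (lin_ext (\<lambda>(x, y, z). c x y z \<odot> tens x y z) v) (x, y, z)
      = (\<Sum>b\<in>keys v. if b = (x, y, z) then c x y z * lookup v b else 0)"
    unfolding lin_ext_def lookup_sum
    by (intro sum.cong) (auto simp: tens_def lookup_single when_def split: prod.splits)
  then show ?thesis by (simp add: in_keys_iff)
qed

text \<open>Supports stay inside the cube, so the intertwining identities need a computation only on
  \<open>cube3 N\<close>.\<close>

lemma Aup_outside:
  assumes "v \<in> V3 N" "q \<notin> cube3 N"
  shows "lookup (Aup1 N v) q = 0" "lookup (Aup2 N v) q = 0" "lookup (Aup3 N v) q = 0"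
    "lookup (Aup1s N v) q = 0" "lookup (Aup2s N v) q = 0" "lookup (Aup3s N v) q = 0"
proof -
  have "x \<in> cube N \<and> y \<in> cube N \<and> z \<in> cube N" if "(x, y, z) \<in> keys v" for x y z
    using assms(1) that by (auto simp: V3_def)
  then show "lookup (Aup1 N v) q = 0" "lookup (Aup2 N v) q = 0" "lookup (Aup3 N v) q = 0"
    "lookup (Aup1s N v) q = 0" "lookup (Aup2s N v) q = 0" "lookup (Aup3s N v) q = 0"
    using assms(2) unfolding Aup1_def Aup2_def Aup3_def Aup1s_def Aup2s_def Aup3s_def lin_ext_def
    by (auto simp: cube3_def lookup_sum tens_def lookup_single when_def nbrs_def adj_def
        split: prod.splits intro!: sum.neutral)
qed

section \<open>Intertwining of the generators\<close>

text \<open>For a permutation matrix the inner sum over \<open>b\<close> has a single term, whose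
  exponent vector is by \<open>prof_change\<close> the profile of the triple \<open>q' i\<close>
  altered at coordinate \<open>i\<close>.\<close>

lemma ddag_poly_act_perm:
  assumes q: "q \<in> cube3 N" and \<phi>: "\<And>a b. \<phi> $ a $ b = (if b = \<sigma> a then 1 else 0)"
    and cube: "\<And>i. i < N \<Longrightarrow> q' i \<in> cube3 N"
    and ctype: "\<And>i. i < N \<Longrightarrow> ctype i (q' i) = \<sigma> (ctype i q)"
    and other: "\<And>i j. j \<noteq> i \<Longrightarrow> ctype j (q' i) = ctype j q"
  shows "lookup (ddag N (poly_act \<phi> p)) q = (\<Sum>i<N. lookup (ddag N p) (q' i))"
  unfolding lookup_ddag_poly_act[OF q]
proof (intro sum.cong refl)
  fix i assume "i \<in> {..<N}"
  then have i: "i < N" by simp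
  have "prof N (q' i) = move (ctype i q) (\<sigma> (ctype i q)) (prof N q)"
    using prof_change[OF i, of "q' i" q] other ctype[OF i] by simp
  then show "(\<Sum>b\<in>UNIV. \<phi> $ ctype i q $ b * (kappa N * mfact (move (ctype i q) b (prof N q)) *
      lookup p (move (ctype i q) b (prof N q)))) = lookup (ddag N p) (q' i)"
    by (simp add: \<phi> lookup_ddag cube[OF i] mult_delta_left)
qed

lemma ddag_poly_act_diagonal:
  assumes q: "q \<in> cube3 N" and \<phi>: "\<And>a b. a \<noteq> b \<Longrightarrow> \<phi> $ a $ b = 0"
  shows "lookup (ddag N (poly_act \<phi> p)) q
    = (\<Sum>a\<in>UNIV. of_nat (lookup (prof N q) a) * \<phi> $ a $ a) * lookup (ddag N p) q"
proof -
  have "(\<Sum>b\<in>UNIV. \<phi> $ ctype i q $ b * (kappa N * mfact (move (ctype i q) b (prof N q)) *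
      lookup p (move (ctype i q) b (prof N q)))) = \<phi> $ ctype i q $ ctype i q * lookup (ddag N p) q"
    if "i < N" for i
  proof -
    let ?c = "ctype i q" and ?w = "\<lambda>m. kappa N * mfact m * lookup p m"
    \<comment> \<open>This is \<open>prof_change\<close> with both triples equal to
      \<open>q\<close>.\<close>
    have m: "move ?c ?c (prof N q) = prof N q"
      using that by (intro prof_change[symmetric]) auto
    have "(\<Sum>b\<in>UNIV. \<phi> $ ?c $ b * ?w (move ?c b (prof N q)))
        = (\<Sum>b\<in>UNIV. if b = ?c then \<phi> $ ?c $ ?c * ?w (move ?c ?c (prof N q)) else 0)"
      by (intro sum.cong) (auto simp: \<phi>)
    then show ?thesis using q by (simp add: m lookup_ddag)
  qed
  then show ?thesis
    using sum_ctype[of "\<lambda>a. \<phi> $ a $ a" q N]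
    by (simp add: lookup_ddag_poly_act[OF q] flip: sum_distrib_right)
qed

text \<open>With \<open>klein2\<close> and \<open>klein3\<close>, the non-identity elements
  (12)(34), (13)(24), (14)(23) of the Klein four-group; \<open>A1\<close>, \<open>A2\<close>,
  \<open>A3\<close> are their permutation matrices.\<close>

definition klein1 :: "4 \<Rightarrow> 4" where "klein1 a = (if a = 1 then 2 else if a = 2 then 1 else if a = 3 then 4 else 3)"
definition klein2 :: "4 \<Rightarrow> 4" where "klein2 a = (if a = 1 then 3 else if a = 2 then 4 else if a = 3 then 1 else 2)"
definition klein3 :: "4 \<Rightarrow> 4" where "klein3 a = (if a = 1 then 4 else if a = 2 then 3 else if a = 3 then 2 else 1)"

lemma generators_nth:
  "A1 $ a $ b = (if b = klein1 a then 1 else 0)"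
  "A2 $ a $ b = (if b = klein2 a then 1 else 0)"
  "A3 $ a $ b = (if b = klein3 a then 1 else 0)"
  "a \<noteq> b \<Longrightarrow> A1s $ a $ b = 0" "a \<noteq> b \<Longrightarrow> A2s $ a $ b = 0" "a \<noteq> b \<Longrightarrow> A3s $ a $ b = 0"
  using exhaust_4[of a] exhaust_4[of b]
  by (auto simp: generator_defs klein1_def klein2_def klein3_def)

text \<open>Negating one sign makes that component odd if all agreed, and conversely; otherwise the
  other two components exchange the role of the odd one.\<close>

lemma ctype_flip:
  assumes "x \<in> cube N" "y \<in> cube N" "z \<in> cube N" "i < N"
  shows "ctype i (flip i x, y, z) = klein1 (ctype i (x, y, z))"
    "ctype i (x, flip i y, z) = klein2 (ctype i (x, y, z))"
    "ctype i (x, y, flip i z) = klein3 (ctype i (x, y, z))"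
  using cube_sign[OF assms(1,4)] cube_sign[OF assms(2,4)] cube_sign[OF assms(3,4)]
  by (elim disjE; simp add: ctype_def flip_def klein1_def klein2_def klein3_def)+

lemma ctype_flip_other:
  "j \<noteq> i \<Longrightarrow> ctype j (flip i x, y, z) = ctype j (x, y, z)"
  "j \<noteq> i \<Longrightarrow> ctype j (x, flip i y, z) = ctype j (x, y, z)"
  "j \<noteq> i \<Longrightarrow> ctype j (x, y, flip i z) = ctype j (x, y, z)"
  by (simp_all add: ctype_def flip_def)

text \<open>\<open>N\<close> is the sum of all four profile entries and the distance a sum of two,
  so subtracting it twice gives these two the sign -1, as on the diagonal of the generator.\<close>

lemma theta_s_prof:
  assumes "q \<in> cube3 N" "q = (x, y, z)"
  shows "theta_s N (path_dist N y z) = (\<Sum>a\<in>UNIV. of_nat (lookup (prof N q) a) * A1s $ a $ a)"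
    "theta_s N (path_dist N z x) = (\<Sum>a\<in>UNIV. of_nat (lookup (prof N q) a) * A2s $ a $ a)"
    "theta_s N (path_dist N x y) = (\<Sum>a\<in>UNIV. of_nat (lookup (prof N q) a) * A3s $ a $ a)"
proof -
  have "N = lookup (prof N q) 1 + lookup (prof N q) 2 + lookup (prof N q) 3 + lookup (prof N q) 4"
    using deg_prof[of N q] by (simp add: deg_def sum_4)
  then have N: "(of_nat N :: complex) = of_nat (lookup (prof N q) 1) + of_nat (lookup (prof N q) 2)
      + of_nat (lookup (prof N q) 3) + of_nat (lookup (prof N q) 4)"
    by (metis of_nat_add)
  note dist = path_dist_prof[OF assms(1)[unfolded assms(2)], folded assms(2)]
  show "theta_s N (path_dist N y z) = (\<Sum>a\<in>UNIV. of_nat (lookup (prof N q) a) * A1s $ a $ a)"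
    "theta_s N (path_dist N z x) = (\<Sum>a\<in>UNIV. of_nat (lookup (prof N q) a) * A2s $ a $ a)"
    "theta_s N (path_dist N x y) = (\<Sum>a\<in>UNIV. of_nat (lookup (prof N q) a) * A3s $ a $ a)"
    unfolding theta_s_def dist N by (simp_all add: sum_4 generator_defs)
qed

lemma ddag_in_V3: "ddag N p \<in> V3 N"
  by (auto simp: V3_def in_keys_iff lookup_ddag cube3_def split: if_splits)

lemma ddag_poly_act_generators:
  "ddag N (poly_act A1 p) = Aup1 N (ddag N p)"
  "ddag N (poly_act A2 p) = Aup2 N (ddag N p)"
  "ddag N (poly_act A3 p) = Aup3 N (ddag N p)"
  "ddag N (poly_act A1s p) = Aup1s N (ddag N p)"
  "ddag N (poly_act A2s p) = Aup2s N (ddag N p)"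
  "ddag N (poly_act A3s p) = Aup3s N (ddag N p)"
proof -
  have eqI: "ddag N p' = v"
    if "\<And>q. q \<notin> cube3 N \<Longrightarrow> lookup v q = 0"
      and "\<And>x y z. (x, y, z) \<in> cube3 N \<Longrightarrow> lookup (ddag N p') (x, y, z) = lookup v (x, y, z)" for p' v
  proof (rule poly_mapping_eqI)
    fix q show "lookup (ddag N p') q = lookup v q"
      using that by (cases q; cases "q \<in> cube3 N") (simp_all add: lookup_ddag)
  qed
  show "ddag N (poly_act A1 p) = Aup1 N (ddag N p)"
  proof (rule eqI)
    fix x y z assume q: "(x, y, z) \<in> cube3 N"
    then have "x \<in> cube N" "y \<in> cube N" "z \<in> cube N" by (simp_all add: cube3_def)
    then show "lookup (ddag N (poly_act A1 p)) (x, y, z) = lookup (Aup1 N (ddag N p)) (x, y, z)"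
      unfolding lookup_Aup(1)[OF \<open>x \<in> cube N\<close> \<open>y \<in> cube N\<close> \<open>z \<in> cube N\<close>]
      by (intro ddag_poly_act_perm[OF q generators_nth(1)])
        (simp_all add: cube3_def ctype_flip ctype_flip_other)
  qed (rule Aup_outside[OF ddag_in_V3])
  show "ddag N (poly_act A2 p) = Aup2 N (ddag N p)"
  proof (rule eqI)
    fix x y z assume q: "(x, y, z) \<in> cube3 N"
    then have "x \<in> cube N" "y \<in> cube N" "z \<in> cube N" by (simp_all add: cube3_def)
    then show "lookup (ddag N (poly_act A2 p)) (x, y, z) = lookup (Aup2 N (ddag N p)) (x, y, z)"
      unfolding lookup_Aup(2)[OF \<open>x \<in> cube N\<close> \<open>y \<in> cube N\<close> \<open>z \<in> cube N\<close>]
      by (intro ddag_poly_act_perm[OF q generators_nth(2)])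
        (simp_all add: cube3_def ctype_flip ctype_flip_other)
  qed (rule Aup_outside[OF ddag_in_V3])
  show "ddag N (poly_act A3 p) = Aup3 N (ddag N p)"
  proof (rule eqI)
    fix x y z assume q: "(x, y, z) \<in> cube3 N"
    then have "x \<in> cube N" "y \<in> cube N" "z \<in> cube N" by (simp_all add: cube3_def)
    then show "lookup (ddag N (poly_act A3 p)) (x, y, z) = lookup (Aup3 N (ddag N p)) (x, y, z)"
      unfolding lookup_Aup(3)[OF \<open>x \<in> cube N\<close> \<open>y \<in> cube N\<close> \<open>z \<in> cube N\<close>]
      by (intro ddag_poly_act_perm[OF q generators_nth(3)])
        (simp_all add: cube3_def ctype_flip ctype_flip_other)
  qed (rule Aup_outside[OF ddag_in_V3])
  show "ddag N (poly_act A1s p) = Aup1s N (ddag N p)"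
    by (rule eqI[OF Aup_outside(4)[OF ddag_in_V3]], assumption, unfold Aup1s_def lookup_diagonal)
      (simp add: theta_s_prof[OF _ refl] ddag_poly_act_diagonal generators_nth)
  show "ddag N (poly_act A2s p) = Aup2s N (ddag N p)"
    by (rule eqI[OF Aup_outside(5)[OF ddag_in_V3]], assumption, unfold Aup2s_def lookup_diagonal)
      (simp add: theta_s_prof[OF _ refl] ddag_poly_act_diagonal generators_nth)
  show "ddag N (poly_act A3s p) = Aup3s N (ddag N p)"
    by (rule eqI[OF Aup_outside(6)[OF ddag_in_V3]], assumption, unfold Aup3s_def lookup_diagonal)
      (simp add: theta_s_prof[OF _ refl] ddag_poly_act_diagonal generators_nth)
qed

theorem theorem17p34:
  fixes N :: nat
  shows "(\<exists>\<rho>. sl4_module pscale (FixG N) \<rho> \<and>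
      (\<forall>v\<in>FixG N.
        \<rho> A1 v = Aup1 N v \<and> \<rho> A2 v = Aup2 N v \<and> \<rho> A3 v = Aup3 N v \<and>
        \<rho> A1s v = Aup1s N v \<and> \<rho> A2s v = Aup2s N v \<and> \<rho> A3s v = Aup3s N v))
    \<and> (\<forall>\<rho>. sl4_module pscale (FixG N) \<rho> \<and>
      (\<forall>v\<in>FixG N.
        \<rho> A1 v = Aup1 N v \<and> \<rho> A2 v = Aup2 N v \<and> \<rho> A3 v = Aup3 N v \<and>
        \<rho> A1s v = Aup1s N v \<and> \<rho> A2s v = Aup2s N v \<and> \<rho> A3s v = Aup3s N v)
      \<longrightarrow> sl4_module_iso pscale (homog N) poly_act pscale (FixG N) \<rho> (ddag N))"
proof (intro conjI allI impI)
  \<comment> \<open>The witness is the action on \<open>homog N\<close> conjugated by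
    \<open>ddag N\<close>; its values on the generators come from
    \<open>ddag_poly_act_generators\<close>.\<close>
  let ?\<rho> = "\<lambda>\<phi> v. ddag N (poly_act \<phi> (inv_into (homog N) (ddag N) v))"
  have "sl4_module pscale (FixG N) ?\<rho>"
    by (rule sl4_module_transport[where f = "ddag N" and ?scale1.0 = pscale, OF sl4_module_homog
          pscale.vector_space_axioms bij_ddag ddag_add ddag_scale])
  moreover have inv: "ddag N (inv_into (homog N) (ddag N) v) = v" if "v \<in> FixG N" for v
    using that bij_ddag[of N] by (simp add: bij_betw_inv_into_right)
  ultimately show "\<exists>\<rho>. sl4_module pscale (FixG N) \<rho> \<and>
      (\<forall>v\<in>FixG N.
        \<rho> A1 v = Aup1 N v \<and> \<rho> A2 v = Aup2 N v \<and> \<rho> A3 v = Aup3 N v \<and>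
        \<rho> A1s v = Aup1s N v \<and> \<rho> A2s v = Aup2s N v \<and> \<rho> A3s v = Aup3s N v)"
    by (intro exI[of _ ?\<rho>] conjI ballI) (simp_all only: ddag_poly_act_generators inv)
next
  fix \<rho>
  assume \<rho>: "sl4_module pscale (FixG N) \<rho> \<and>
      (\<forall>v\<in>FixG N.
        \<rho> A1 v = Aup1 N v \<and> \<rho> A2 v = Aup2 N v \<and> \<rho> A3 v = Aup3 N v \<and>
        \<rho> A1s v = Aup1s N v \<and> \<rho> A2s v = Aup2s N v \<and> \<rho> A3s v = Aup3s N v)"
  have "ddag N p \<in> FixG N" if "p \<in> homog N" for p
    using that bij_ddag[of N] by (auto simp: bij_betw_def)
  then show "sl4_module_iso pscale (homog N) poly_act pscale (FixG N) \<rho> (ddag N)"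
    using \<rho> by (intro sl4_module_isoI[where f = "ddag N" and ?scale1.0 = pscale, OF sl4_module_homog _ bij_ddag ddag_add ddag_scale])
      (auto simp only: ddag_poly_act_generators insert_iff empty_iff)
qed

end
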